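(* Let $d,n\geq 1$ and let $C\in\mathbb{R}^{dn\times dn}$ be a real symmetric positive semidefinite matrix with $d\times d$ blocks $C_{ij}$. Let $X_1,\dots,X_n\in\mathbb{R}^{d\times nd}$ be an optimal solution of \[ \max_{\substack{X_iX_i^T=I_{d\times d},\ X_i\in\mathbb{R}^{d\times nd}}}\ \sum_{i=1}^n\sum_{j=1}^n\operatorname{tr}\left(C_{ij}^TX_iX_j^T\right), \] let $R\in\mathbb{R}^{nd\times d}$ have i.i.d. real $\mathcal{N}(0,\frac1d)$ entries, and set $V_i=\mathcal{P}(X_iR)$ for $i=1,\dots,n$. Then \[ \mathbb{E} \left[ \sum_{i=1}^n\sum_{j=1}^n\operatorname{tr}\left(C_{ij}^TV_iV_j^T\right) \right] \geq \alpha_{\mathbb{R}}(d)^2 \max_{O_1,\dots,O_n \in \mathcal{O}_d} \sum_{i=1}^n\sum_{j=1}^n\operatorname{tr}\left(C_{ij}^TO_iO_j^T\right). \] Analogously, let $C\in\mathbb{C}^{dn\times dn}$ be Hermitian positive semidefinite, let $Y_1,\dots,Y_n\in\mathbb{C}^{d\times nd}$ be an optimal solution of \[ \max_{\substack{Y_iY_i^H=I_{d\times d},\ Y_i\in\mathbb{C}^{d\times nd}}}\ \sum_{i=1}^n\sum_{j=1}^n\operatorname{tr}\left(C_{ij}^HY_iY_j^H\right), \] let $R\in\mathbb{C}^{nd\times d}$ have i.i.d. complex Gaussian $\mathcal{N}(0,\frac1d)$ entries, and set $W_i=\mathcal{P}(Y_iR)$. Then \[ \mathbb{E} \left[ \sum_{i=1}^n\sum_{j=1}^n\operatorname{tr}\left(C_{ij}^HW_iW_j^H\right)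 \right] \geq \alpha_{\mathbb{C}}(d)^2 \max_{U_1,\dots,U_n \in \mathcal{U}_d} \sum_{i=1}^n\sum_{j=1}^n\operatorname{tr}\left(C_{ij}^HU_iU_j^H\right). \]
   Context: $\mathcal{O}_d$ is the group of real $d\times d$ orthogonal matrices and $\mathcal{U}_d$ the group of complex $d\times d$ unitary matrices. $C_{ij}$ denotes the $(i,j)$-th $d\times d$ block of $C$. For a real $d\times d$ matrix $X$, $\mathcal{P}(X)=\operatorname{argmin}_{Z\in\mathcal{O}_d}\|Z-X\|_F$ (the orthogonal polar factor, $UV^T$ if $X=U\Sigma V^T$ is an SVD); for a complex $d\times d$ matrix $Y$, $\mathcal{P}(Y)=\operatorname{argmin}_{Z\in\mathcal{U}_d}\|Z-Y\|_F$. A complex Gaussian $\mathcal{N}(0,\frac1d)$ entry is circularly symmetric with $\mathbb{E}|z|^2=\frac1d$. Let $G_{\mathbb{R}}\in\mathbb{R}^{d\times d}$ have i.i.d. real $\mathcal{N}(0,d^{-1})$ entries and $G_{\mathbb{C}}\in\mathbb{C}^{d\times d}$ i.i.d. complex $\mathcal{N}(0,d^{-1})$ entries; define $\alpha_{\mathbb{R}}(d)=\mathbb{E}\left[\frac1d\sum_{j=1}^d\sigma_j(G_{\mathbb{R}})\right]$ and $\alpha_{\mathbb{C}}(d)=\mathbb{E}\left[\frac1d\sum_{j=1}^d\sigma_j(G_{\mathbb{C}})\right]$, where $\sigma_j$ denotes the $j$-th singular value. *)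

theory Defs
  imports "HOL-Analysis.Analysis" "HOL-Probability.Probability"
begin

(* Matrices are HOL-Analysis matrices  'a^'cols^'rows.  The dimension d is the
   cardinality of the finite type 'd, the number of blocks n that of 'n; the
   index set of R^{dn} is the product type 'n \<times> 'd, index (i,a) = a-th coordinate
   of the i-th block. *)

definition blk :: "'a^('n::finite \<times> 'd::finite)^('n \<times> 'd) \<Rightarrow> 'n \<Rightarrow> 'n \<Rightarrow> 'a^'d^'d" where
  "blk C i j = (\<chi> a b. C $ (i, a) $ (j, b))"

definition cadj :: "complex^'c^'r \<Rightarrow> complex^'r^'c" where
  "cadj A = (\<chi> i j. cnj (A $ j $ i))"

definition unitary_matrix :: "complex^'d^'d \<Rightarrow> bool" where
  "unitary_matrix U \<longleftrightarrow> cadj U ** U = mat 1 \<and> U ** cadj U = mat 1"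

definition psd_real :: "real^'m^'m \<Rightarrow> bool" where
  "psd_real C \<longleftrightarrow> transpose C = C \<and> (\<forall>x. 0 \<le> x \<bullet> (C *v x))"

definition psd_herm :: "complex^'m^'m \<Rightarrow> bool" where
  "psd_herm C \<longleftrightarrow> cadj C = C \<and> (\<forall>x. 0 \<le> Re (\<Sum>k\<in>UNIV. cnj (x $ k) * (C *v x) $ k))"

definition obj_real :: "real^('n::finite \<times> 'd::finite)^('n \<times> 'd) \<Rightarrow> ('n \<Rightarrow> real^'c::finite^'d) \<Rightarrow> real" where
  "obj_real C V = (\<Sum>i\<in>UNIV. \<Sum>j\<in>UNIV. trace (transpose (blk C i j) ** V i ** transpose (V j)))"

(* objective  sum_i sum_j tr(C_ij^H V_i V_j^H)  (real for Hermitian C; we take the real part) *)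
definition obj_cplx :: "complex^('n::finite \<times> 'd::finite)^('n \<times> 'd) \<Rightarrow> ('n \<Rightarrow> complex^'c::finite^'d) \<Rightarrow> real" where
  "obj_cplx C V = Re (\<Sum>i\<in>UNIV. \<Sum>j\<in>UNIV. trace (cadj (blk C i j) ** V i ** cadj (V j)))"

(* orthogonal / unitary polar factor: a Frobenius-norm nearest orthogonal (unitary) matrix;
   the HOL norm on 'a^'d^'d is exactly the Frobenius norm. *)
definition polar_real :: "real^'d^'d \<Rightarrow> real^'d^'d" where
  "polar_real X = (SOME Z. orthogonal_matrix Z \<and>
      (\<forall>Z'. orthogonal_matrix Z' \<longrightarrow> norm (Z - X) \<le> norm (Z' - X)))"

definition polar_cplx :: "complex^'d^'d \<Rightarrow> complex^'d^'d" where
  "polar_cplx X = (SOME Z. unitary_matrix Z \<and>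
      (\<forall>Z'. unitary_matrix Z' \<longrightarrow> norm (Z - X) \<le> norm (Z' - X)))"

definition sv_sum_real :: "real^'d^'d \<Rightarrow> real" where
  "sv_sum_real G = (THE s. \<exists>U S V. orthogonal_matrix U \<and> orthogonal_matrix V \<and>
      (\<forall>i j. i \<noteq> j \<longrightarrow> S $ i $ j = 0) \<and> (\<forall>i. 0 \<le> S $ i $ i) \<and>
      G = U ** S ** transpose V \<and> s = trace S)"

definition sv_sum_cplx :: "complex^'d^'d \<Rightarrow> real" where
  "sv_sum_cplx G = (THE s. \<exists>U (S::real^'d^'d) V. unitary_matrix U \<and> unitary_matrix V \<and>
      (\<forall>i j. i \<noteq> j \<longrightarrow> S $ i $ j = 0) \<and> (\<forall>i. 0 \<le> S $ i $ i) \<and>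
      G = U ** (\<chi> i j. complex_of_real (S $ i $ j)) ** cadj V \<and> s = trace S)"

definition gauss_real_mat :: "real \<Rightarrow> (real^'c::finite^'r::finite) measure" where
  "gauss_real_mat v = density lebesgue
     (\<lambda>R. ennreal (\<Prod>i\<in>UNIV. \<Prod>j\<in>UNIV. normal_density 0 (sqrt v) (R $ i $ j)))"

(* law of a matrix with i.i.d. circularly symmetric complex N(0,v) entries (E|z|^2 = v):
   real and imaginary parts independent N(0,v/2) *)
definition gauss_cplx_mat :: "real \<Rightarrow> (complex^'c::finite^'r::finite) measure" where
  "gauss_cplx_mat v = density lebesgue
     (\<lambda>R. ennreal (\<Prod>i\<in>UNIV. \<Prod>j\<in>UNIV.
         normal_density 0 (sqrt (v / 2)) (Re (R $ i $ j)) * normal_density 0 (sqrt (v / 2)) (Im (R $ i $ j))))"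

definition alpha_real :: "'d::finite itself \<Rightarrow> real" where
  "alpha_real _ = integral\<^sup>L (gauss_real_mat (1 / real CARD('d)) :: (real^'d^'d) measure)
      (\<lambda>G. sv_sum_real G / real CARD('d))"

definition alpha_cplx :: "'d::finite itself \<Rightarrow> real" where
  "alpha_cplx _ = integral\<^sup>L (gauss_cplx_mat (1 / real CARD('d)) :: (complex^'d^'d) measure)
      (\<lambda>G. sv_sum_cplx G / real CARD('d))"

end

theory Submission
  imports Defs "HOL-Computational_Algebra.Polynomial"
begin

text \<open>
  Write \<open>\<alpha>\<close> for the constant, \<open>A \<bullet> B = Re tr (A B\<^sup>H)\<close>, and \<open>V\<^sub>i = P(X\<^sub>i R)\<close>. For every Borel map
  \<open>\<Phi>\<close> with \<open>\<Phi>(Q G) = Q \<Phi>(G)\<close> for unitary \<open>Q\<close>, the invariance of the Gaussian law under \<open>R \<mapsto> Q R\<close>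
  gives \<open>E[\<Phi>(M R) \<bullet> B R] = (M \<bullet> B) E[\<Phi>(G) \<bullet> G] / d\<close> whenever \<open>M M\<^sup>H = I\<close>. Taking for \<open>\<Phi>\<close> the polar factor
  and the identity, and using that \<open>P(G) \<bullet> G\<close> is the sum of the singular values of \<open>G\<close>, one finds
  \<open>E[V\<^sub>i \<bullet> B R] = \<alpha> X\<^sub>i \<bullet> B\<close> and \<open>E[X\<^sub>i R \<bullet> B R] = X\<^sub>i \<bullet> B\<close>. Since \<open>C\<close> is positive semidefinite, the
  objective is nonnegative at \<open>V\<^sub>i - \<alpha> X\<^sub>i R\<close>, and taking expectations yields
  \<open>0 \<le> E[obj V] - 2 \<alpha>\<^sup>2 obj X + \<alpha>\<^sup>2 obj X\<close>. The relaxation \<open>X\<close> dominates every feasible point of the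
  original problem. The real and the complex case are treated at once, over a field with conjugation.
\<close>

subsection \<open>Isotropic Gaussian measures on Euclidean spaces\<close>

lemma nn_integral_lborel_shift:
  fixes h :: "'a::euclidean_space \<Rightarrow> ennreal"
  assumes [measurable]: "h \<in> borel_measurable borel"
  shows "(\<integral>\<^sup>+x. h (x + a) \<partial>lborel) = (\<integral>\<^sup>+x. h x \<partial>lborel)"
proof -
  have "(\<integral>\<^sup>+x. h x \<partial>lborel) = (\<integral>\<^sup>+x. h x \<partial>distr lborel borel ((+) a))"
    by (simp add: lborel_distr_plus)
  also have "\<dots> = (\<integral>\<^sup>+x. h (x + a) \<partial>lborel)"
    by (subst nn_integral_distr) (auto simp: add.commute)
  finally show ?thesis ..
qed

text \<open>The image measure is translation invariant, so Tonelli's theorem shows that it is proportional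
  to Lebesgue measure; the unit ball, being invariant, fixes the factor.\<close>

lemma lborel_distr_orthogonal_transformation:
  fixes f :: "'a::euclidean_space \<Rightarrow> 'a"
  assumes f: "orthogonal_transformation f"
  shows "distr lborel borel f = lborel"
proof (rule measure_eqI)
  fix S assume S: "S \<in> sets (distr lborel borel f)"
  have lin: "linear f" using f by (rule orthogonal_transformation_linear)
  then have [measurable]: "f \<in> borel_measurable borel"
    by (intro borel_measurable_continuous_onI linear_continuous_on linear_conv_bounded_linear[THEN iffD1])
  obtain f' where f': "\<And>x. f (f' x) = x"
    using orthogonal_transformation_surj[OF f] by (metis surj_def)
  \<comment> \<open>The indicator depends on the norm alone and has a positive finite integral,
    which can be cancelled at the end.\<close>
  define g :: "'a \<Rightarrow> ennreal" where "g = indicator (ball 0 1)"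
  define h :: "'a \<Rightarrow> ennreal" where "h = indicator S"
  have [measurable]: "g \<in> borel_measurable borel" "h \<in> borel_measurable borel"
    using S by (auto simp: g_def h_def intro!: borel_measurable_indicator)
  have g_norm: "g x = g y" if "norm x = norm y" for x y
    using that by (auto simp: g_def indicator_def)
  have g_pos: "(\<integral>\<^sup>+x. g x \<partial>lborel) \<noteq> 0" "(\<integral>\<^sup>+x. g x \<partial>lborel) \<noteq> \<top>"
    using emeasure_lborel_ball_finite[of "0::'a" 1] content_ball_pos[of 1 "0::'a"]
    by (auto simp: g_def measure_def)
  have "(\<integral>\<^sup>+x. g x \<partial>lborel) * (\<integral>\<^sup>+y. h (f y) \<partial>lborel) = (\<integral>\<^sup>+x. g x * (\<integral>\<^sup>+y. h (f y) \<partial>lborel) \<partial>lborel)"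
    by (simp add: nn_integral_multc)
  also have "\<dots> = (\<integral>\<^sup>+x. g x * (\<integral>\<^sup>+y. h (f y + x) \<partial>lborel) \<partial>lborel)"
  proof (rule nn_integral_cong)
    fix x
    \<comment> \<open>Shifting \<open>y\<close> by \<open>f' x\<close> adds
      \<open>f (f' x) = x\<close> to \<open>f y\<close>.\<close>
    show "g x * (\<integral>\<^sup>+y. h (f y) \<partial>lborel) = g x * (\<integral>\<^sup>+y. h (f y + x) \<partial>lborel)"
      using nn_integral_lborel_shift[of "\<lambda>y. h (f y)" "f' x"]
      by (simp add: linear_add[OF lin] f')
  qed
  also have "\<dots> = (\<integral>\<^sup>+x. (\<integral>\<^sup>+y. g x * h (f y + x) \<partial>lborel) \<partial>lborel)"
    by (simp add: nn_integral_cmult)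
  also have "\<dots> = (\<integral>\<^sup>+y. (\<integral>\<^sup>+x. g x * h (f y + x) \<partial>lborel) \<partial>lborel)"
    by (rule lborel_pair.Fubini') simp
  also have "\<dots> = (\<integral>\<^sup>+y. (\<integral>\<^sup>+x. g (x - f y) * h x \<partial>lborel) \<partial>lborel)"
  proof (rule nn_integral_cong)
    fix y
    show "(\<integral>\<^sup>+x. g x * h (f y + x) \<partial>lborel) = (\<integral>\<^sup>+x. g (x - f y) * h x \<partial>lborel)"
      using nn_integral_lborel_shift[of "\<lambda>x. g (x - f y) * h x" "f y"] by (simp add: add.commute)
  qed
  also have "\<dots> = (\<integral>\<^sup>+x. (\<integral>\<^sup>+y. g (x - f y) * h x \<partial>lborel) \<partial>lborel)"
    by (rule lborel_pair.Fubini') simp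
  also have "\<dots> = (\<integral>\<^sup>+x. (\<integral>\<^sup>+y. g y \<partial>lborel) * h x \<partial>lborel)"
  proof (rule nn_integral_cong)
    fix x
    have "(\<integral>\<^sup>+y. g (x - f y) \<partial>lborel) = (\<integral>\<^sup>+y. g (y + (- f' x)) \<partial>lborel)"
    proof (intro nn_integral_cong g_norm)
      fix y
      \<comment> \<open>Writing \<open>x\<close> as \<open>f (f' x)\<close> turns the distance from
        \<open>x\<close> to \<open>f y\<close> into the distance from \<open>f' x\<close> to
        \<open>y\<close>, so the radial \<open>g\<close> only sees a translate of
        \<open>y\<close>.\<close>
      have "norm (x - f y) = norm (f (f' x - y))" by (simp add: linear_diff[OF lin] f')
      also have "\<dots> = norm (y + (- f' x))"
        by (simp add: orthogonal_transformation_norm[OF f] norm_minus_commute)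
      finally show "norm (x - f y) = norm (y + (- f' x))" .
    qed
    then show "(\<integral>\<^sup>+y. g (x - f y) * h x \<partial>lborel) = (\<integral>\<^sup>+y. g y \<partial>lborel) * h x"
      by (simp add: nn_integral_multc nn_integral_lborel_shift[of g "- f' x", simplified])
  qed
  also have "\<dots> = (\<integral>\<^sup>+x. g x \<partial>lborel) * (\<integral>\<^sup>+x. h x \<partial>lborel)"
    by (simp add: nn_integral_cmult)
  finally have "(\<integral>\<^sup>+y. h (f y) \<partial>lborel) = (\<integral>\<^sup>+x. h x \<partial>lborel)"
    using g_pos by (simp add: ennreal_mult_cancel_left)
  moreover have "(\<integral>\<^sup>+y. h (f y) \<partial>lborel) = (\<integral>\<^sup>+x. h x \<partial>distr lborel borel f)"
    by (subst nn_integral_distr) auto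
  ultimately show "emeasure (distr lborel borel f) S = emeasure lborel S"
    using S by (simp add: h_def)
qed simp

section \<open>The isotropic Gaussian law: product structure and invariance\<close>

definition gauss_density :: "real \<Rightarrow> 'a::euclidean_space \<Rightarrow> real" where
  "gauss_density s x = (1 / sqrt (2 * pi * s\<^sup>2)) ^ DIM('a) * exp (- (norm x)\<^sup>2 / (2 * s\<^sup>2))"

text \<open>The density depends on the norm only, which makes rotation invariance immediate. The
  base measure is \<open>lborel\<close>, so that products and images stay on Borel sets;
  \<open>integral_density_lebesgue_gauss\<close> links it to the version over
  \<open>lebesgue\<close>.\<close>

definition gauss :: "real \<Rightarrow> 'a::euclidean_space measure" where
  "gauss s = density lborel (\<lambda>x. ennreal (gauss_density s x))"

lemma gauss_density_nonneg [simp]: "0 \<le> gauss_density s x"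
  by (simp add: gauss_density_def)

lemma borel_measurable_gauss_density [measurable]: "gauss_density s \<in> borel_measurable borel"
  unfolding gauss_density_def by measurable

lemma sets_gauss [measurable_cong, simp]: "sets (gauss s) = sets borel"
  by (simp add: gauss_def)

lemma space_gauss [simp]: "space (gauss s) = UNIV"
  by (simp add: gauss_def)

lemma gauss_density_real: "gauss_density s (x::real) = normal_density 0 s x"
  by (simp add: gauss_density_def normal_density_def)

lemma gauss_density_Basis:
  "gauss_density s (x::'a::euclidean_space) = (\<Prod>b\<in>Basis. normal_density 0 s (x \<bullet> b))"
proof -
  have "(norm x)\<^sup>2 = (\<Sum>b\<in>Basis. (x \<bullet> b)\<^sup>2)"
    by (subst power2_norm_eq_inner, subst euclidean_inner) (simp add: power2_eq_square)
  then have "exp (- (norm x)\<^sup>2 / (2 * s\<^sup>2)) = (\<Prod>b\<in>Basis. exp (- (x \<bullet> b)\<^sup>2 / (2 * s\<^sup>2)))"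
    by (simp add: exp_sum[symmetric] sum_divide_distrib sum_negf)
  then show ?thesis
    by (simp only: gauss_density_def normal_density_def prod.distrib prod_constant) simp
qed

lemma gauss_density_Pair:
  "gauss_density s (x::'a::euclidean_space, y::'b::euclidean_space) = gauss_density s x * gauss_density s y"
proof -
  have "- (norm (x, y))\<^sup>2 / (2 * s\<^sup>2) = - (norm x)\<^sup>2 / (2 * s\<^sup>2) + - (norm y)\<^sup>2 / (2 * s\<^sup>2)"
    by (simp add: norm_Pair add_divide_distrib diff_divide_distrib)
  then show ?thesis
    by (simp only: gauss_density_def DIM_prod power_add exp_add) (simp add: mult_ac)
qed

text \<open>The density factors over an orthonormal basis, which reduces the total mass to a product
  of one-dimensional normal integrals.\<close>

lemma prob_space_gauss:
  assumes "0 < s"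
  shows "prob_space (gauss s :: 'a::euclidean_space measure)"
proof
  have "emeasure (gauss s) (space (gauss s :: 'a measure)) = (\<integral>\<^sup>+x. ennreal (\<Prod>b\<in>(Basis::'a set). normal_density 0 s (x \<bullet> b)) \<partial>lborel)"
    by (simp add: gauss_def emeasure_density gauss_density_Basis)
  also have "\<dots> = (\<integral>\<^sup>+x. (\<Prod>b\<in>(Basis::'a set). ennreal (normal_density 0 s (x \<bullet> b))) \<partial>lborel)"
    by (simp add: prod_ennreal)
  also have "\<dots> = (\<Prod>b\<in>(Basis::'a set). (\<integral>\<^sup>+x. ennreal (normal_density 0 s x) \<partial>lborel))"
    by (rule nn_integral_lborel_prod) auto
  also have "(\<integral>\<^sup>+x. ennreal (normal_density 0 s x) \<partial>lborel) = 1"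
    using assms by (subst nn_integral_eq_integral) auto
  finally show "emeasure (gauss s) (space (gauss s :: 'a measure)) = 1" by simp
qed

text \<open>Lebesgue measure and the radial density are both invariant.\<close>

lemma gauss_orthogonal_transformation:
  fixes f :: "'a::euclidean_space \<Rightarrow> 'a"
  assumes f: "orthogonal_transformation f"
  shows "distr (gauss s) borel f = gauss s"
proof -
  have [measurable]: "f \<in> borel_measurable borel"
    using orthogonal_transformation_linear[OF f]
    by (intro borel_measurable_continuous_onI linear_continuous_on linear_conv_bounded_linear[THEN iffD1])
  have "gauss s = density (distr lborel borel f) (\<lambda>x. ennreal (gauss_density s x))"
    by (simp add: gauss_def lborel_distr_orthogonal_transformation[OF f])
  also have "\<dots> = distr (density lborel (\<lambda>x. ennreal (gauss_density s (f x)))) borel f"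
    by (subst density_distr) auto
  also have "(\<lambda>x. gauss_density s (f x)) = gauss_density s"
    by (simp add: fun_eq_iff gauss_density_def orthogonal_transformation_norm[OF f])
  finally show ?thesis by (simp add: gauss_def)
qed

text \<open>The density is multiplicative, so independent Gaussians form a Gaussian on the product
  space, to which isometries mixing the two components can be applied.\<close>

lemma gauss_pair:
  assumes "0 < s"
  shows "gauss s \<Otimes>\<^sub>M gauss s = (gauss s :: ('a::euclidean_space \<times> 'b::euclidean_space) measure)"
proof -
  interpret B: prob_space "gauss s :: 'b measure" by (rule prob_space_gauss[OF assms])
  have "gauss s \<Otimes>\<^sub>M gauss s = density (lborel \<Otimes>\<^sub>M lborel)
      (\<lambda>(x::'a, y::'b). ennreal (gauss_density s x) * ennreal (gauss_density s y))"
    unfolding gauss_def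
    by (rule pair_measure_density)
      (use B.sigma_finite_measure_axioms lborel.sigma_finite_measure_axioms in \<open>auto simp: gauss_def\<close>)
  also have "(\<lambda>(x::'a, y::'b). ennreal (gauss_density s x) * ennreal (gauss_density s y)) =
      (\<lambda>z. ennreal (gauss_density s z))"
    by (auto simp: gauss_density_Pair ennreal_mult)
  finally show ?thesis
    by (simp add: lborel_prod gauss_def)
qed

text \<open>The law of \<open>L x\<close> is found by completing \<open>L\<close> to the isometry
  \<open>(y, x) \<mapsto> (L x, x - L\<^sup>* L x + L\<^sup>* y)\<close> of the product space.\<close>

lemma distr_gauss_coisometry:
  fixes L :: "'a::euclidean_space \<Rightarrow> 'b::euclidean_space"
  assumes s: "0 < s" and L: "linear L" and LL: "\<And>y. L (adjoint L y) = y"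
  shows "distr (gauss s) borel L = gauss s"
proof -
  interpret A: prob_space "gauss s :: 'a measure" by (rule prob_space_gauss[OF s])
  interpret B: prob_space "gauss s :: 'b measure" by (rule prob_space_gauss[OF s])
  define \<Phi> where "\<Phi> = (\<lambda>(y, x). (L x, x - adjoint L (L x) + adjoint L y))"
  have L': "linear (adjoint L)" by (rule adjoint_linear[OF L])
  have [measurable]: "L \<in> borel_measurable borel"
    using L by (intro borel_measurable_continuous_onI linear_continuous_on linear_conv_bounded_linear[THEN iffD1])
  have [measurable]: "adjoint L \<in> borel_measurable borel"
    using L' by (intro borel_measurable_continuous_onI linear_continuous_on linear_conv_bounded_linear[THEN iffD1])
  have inner_adj': "x \<bullet> adjoint L y = L x \<bullet> y" for x y
    by (rule adjoint_works[OF L])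
  have inner_adj: "adjoint L y \<bullet> x = y \<bullet> L x" for x y
    using inner_adj'[of x y] by (simp add: inner_commute)
  have "orthogonal_transformation \<Phi>"
    unfolding orthogonal_transformation_def
  proof (intro conjI allI)
    show "linear \<Phi>"
      by (rule linearI) (auto simp: \<Phi>_def linear_add[OF L] linear_add[OF L'] linear_cmul[OF L]
          linear_cmul[OF L'] algebra_simps)
    fix v w show "\<Phi> v \<bullet> \<Phi> w = v \<bullet> w"
      by (cases v; cases w) (simp add: \<Phi>_def inner_add inner_diff inner_adj inner_adj' LL linear_add[OF L] linear_diff[OF L])
  qed
  note inv = gauss_orthogonal_transformation[OF this, of s]
  have [measurable]: "\<Phi> \<in> borel_measurable borel"
    unfolding \<Phi>_def borel_prod[symmetric] by measurable
  have fst_gauss: "distr (gauss s :: ('b \<times> 'a) measure) borel fst = gauss s"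
    unfolding gauss_pair[OF s, symmetric] using A.distr_pair_fst[of "gauss s :: 'b measure"]
    by (simp cong: distr_cong)
  have snd_gauss: "distr (gauss s :: ('b \<times> 'a) measure) borel snd = gauss s"
  proof (rule measure_eqI)
    fix S assume S: "S \<in> sets (distr (gauss s :: ('b \<times> 'a) measure) borel snd)"
    have *: "snd -` S \<inter> space (gauss s :: ('b \<times> 'a) measure) = UNIV \<times> S" by auto
    have "emeasure (distr (gauss s :: ('b \<times> 'a) measure) borel snd) S = emeasure (gauss s) ((UNIV :: 'b set) \<times> S)"
      using S by (subst emeasure_distr) (auto simp del: space_gauss simp: * measurable_snd borel_prod[symmetric] cong: measurable_cong_sets)
    also have "\<dots> = emeasure (gauss s :: 'b measure) UNIV * emeasure (gauss s) S"
      unfolding gauss_pair[OF s, symmetric] using S by (subst A.emeasure_pair_measure_Times) auto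
    finally show "emeasure (distr (gauss s :: ('b \<times> 'a) measure) borel snd) S = emeasure (gauss s) S"
      using B.emeasure_space_1 by simp
  qed simp
  have [measurable]: "fst \<in> borel_measurable (borel :: ('b \<times> 'a) measure)"
    "snd \<in> borel_measurable (borel :: ('b \<times> 'a) measure)"
    unfolding borel_prod[symmetric] by measurable
  \<comment> \<open>\<open>L x\<close> is the first component of \<open>\<Phi>\<close> at an
    independent pair; \<open>\<Phi>\<close> preserves the law of the pair, so the first marginal
    remains.\<close>
  have "distr (gauss s) borel L = distr (distr (gauss s :: ('b \<times> 'a) measure) borel snd) borel L"
    by (simp add: snd_gauss)
  also have "\<dots> = distr (gauss s :: ('b \<times> 'a) measure) borel (\<lambda>z. fst (\<Phi> z))"
    by (subst distr_distr) (auto simp: o_def \<Phi>_def case_prod_unfold)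
  also have "\<dots> = distr (distr (gauss s) borel \<Phi>) borel fst"
    by (subst distr_distr) (auto simp: o_def)
  also have "\<dots> = gauss s"
    by (simp add: inv fst_gauss)
  finally show ?thesis .
qed

section \<open>Second moments, and the passage from Lebesgue to Borel measurability\<close>

lemma distr_gauss_inner:
  fixes u :: "'a::euclidean_space"
  assumes s: "0 < s" and u: "norm u = 1"
  shows "distr (gauss s) borel (\<lambda>x. x \<bullet> u) = density lborel (normal_density 0 s)"
proof -
  have "adjoint (\<lambda>x. x \<bullet> u) = (\<lambda>t. t *\<^sub>R u)"
    by (rule adjoint_unique) simp
  then have "distr (gauss s) borel (\<lambda>x. x \<bullet> u) = gauss s"
    using u by (intro distr_gauss_coisometry[OF s])
      (auto intro!: linearI simp: inner_add_left norm_eq_1)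
  then show ?thesis by (simp add: gauss_def gauss_density_real)
qed

text \<open>The coordinate along a unit vector is a centred normal variable with variance
  \<open>s^2\<close>.\<close>

lemma has_bochner_integral_gauss_inner_square:
  fixes u :: "'a::euclidean_space"
  assumes s: "0 < s" and u: "norm u = 1"
  shows "has_bochner_integral (gauss s) (\<lambda>x. (x \<bullet> u)\<^sup>2) (s\<^sup>2)"
proof -
  have "has_bochner_integral lborel (\<lambda>x. normal_density 0 s x * (x - 0) ^ (2 * 1)) (fact (2 * 1) / ((2 / s\<^sup>2) ^ 1 * fact 1))"
    by (rule normal_moment_even[OF s])
  then have "has_bochner_integral lborel (\<lambda>x. normal_density 0 s x *\<^sub>R x\<^sup>2) (s\<^sup>2)"
    by simp
  then have "has_bochner_integral (density lborel (normal_density 0 s)) (\<lambda>x. x\<^sup>2) (s\<^sup>2)"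
    by (rule has_bochner_integral_density[rotated -1]) auto
  then show ?thesis
    unfolding distr_gauss_inner[OF s u, symmetric]
    by (simp add: has_bochner_integral_iff integrable_distr_eq integral_distr)
qed

lemma has_bochner_integral_gauss_norm_square:
  assumes s: "0 < s"
  shows "has_bochner_integral (gauss s) (\<lambda>x::'a::euclidean_space. (norm x)\<^sup>2) (s\<^sup>2 * DIM('a))"
proof -
  have "has_bochner_integral (gauss s) (\<lambda>x::'a. \<Sum>b\<in>Basis. (x \<bullet> b)\<^sup>2) (\<Sum>b\<in>(Basis::'a set). s\<^sup>2)"
    by (intro has_bochner_integral_sum has_bochner_integral_gauss_inner_square[OF s]) simp
  moreover have "(\<Sum>b\<in>Basis. (x \<bullet> b)\<^sup>2) = (norm x)\<^sup>2" for x :: 'a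
    by (subst power2_norm_eq_inner, subst euclidean_inner) (simp add: power2_eq_square)
  ultimately show ?thesis by (simp add: mult.commute)
qed

text \<open>Completeness of Lebesgue measure makes \<open>f\<close> measurable once it agrees almost
  everywhere with a Borel function. This allows \<open>polar\<close>, an arbitrary choice at
  singular matrices, to be replaced by a Borel map under the integral.\<close>

lemma integral_density_lebesgue_gauss:
  fixes f g :: "'a::euclidean_space \<Rightarrow> real"
  assumes g: "g \<in> borel_measurable borel" and fg: "AE x in lborel. f x = g x"
  shows "integral\<^sup>L (density lebesgue (\<lambda>x. ennreal (gauss_density s x))) f = integral\<^sup>L (gauss s) g"
proof -
  have g': "g \<in> borel_measurable lebesgue"
    using g by (simp add: measurable_completion)
  have AE: "AE x in lebesgue. f x = g x"
    using fg by (rule AE_completion)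
  then have f': "f \<in> borel_measurable lebesgue"
    by (intro borel_measurable_AE[OF g']) auto
  have "integral\<^sup>L (density lebesgue (\<lambda>x. ennreal (gauss_density s x))) f = (\<integral>x. gauss_density s x *\<^sub>R f x \<partial>lebesgue)"
    using f' by (intro integral_density) (auto simp: measurable_completion)
  also have "\<dots> = (\<integral>x. gauss_density s x *\<^sub>R g x \<partial>lebesgue)"
    using AE f' g'
    by (intro integral_cong_AE borel_measurable_scaleR measurable_completion[of "gauss_density s"]) auto
  also have "\<dots> = (\<integral>x. gauss_density s x *\<^sub>R g x \<partial>lborel)"
    using g by (intro integral_completion) auto
  also have "\<dots> = integral\<^sup>L (gauss s) g"
    using g unfolding gauss_def by (intro integral_density[symmetric]) auto
  finally show ?thesis .
qed

subsection \<open>Unitary matrices over a field with conjugation\<close>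

lemma inner_1_1 [simp]: "(1::'k::{euclidean_space,real_normed_field}) \<bullet> 1 = 1"
  by (rule norm_eq_1[THEN iffD1]) simp

lemma inner_of_real: "of_real r \<bullet> (x::'k::{euclidean_space,real_normed_field}) = r * (1 \<bullet> x)"
  by (simp add: of_real_def)

text \<open>This is the equality case of the Cauchy-Schwarz inequality against
  \<open>1\<close>.\<close>

lemma eq_of_real_norm:
  assumes "norm x \<le> x \<bullet> 1"
  shows "x = of_real (norm (x::'k::{euclidean_space,real_normed_field}))"
proof -
  have "x \<bullet> 1 = norm x * norm (1::'k)"
    using assms norm_cauchy_schwarz[of x "1::'k"] by simp
  then show ?thesis by (subst (asm) norm_cauchy_schwarz_eq) (simp add: of_real_def)
qed

text \<open>The choice \<open>t = q\<close> for nonpositive \<open>p\<close>, and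
  \<open>t = q / (2 * p)\<close> otherwise, forces \<open>q^2 \<le> 0\<close>. This replaces
  differentiation in first-order optimality arguments.\<close>

lemma eq_0_if_linear_le_quadratic:
  fixes p q :: real
  assumes "\<And>t. t * q \<le> t\<^sup>2 * p"
  shows "q = 0"
proof (cases "p \<le> 0")
  case True
  have "q * q \<le> q\<^sup>2 * p" by (rule assms)
  also have "\<dots> \<le> 0" using True by (simp add: mult_nonneg_nonpos)
  finally show ?thesis by (metis mult_eq_0_iff mult_le_0_iff order_antisym)
next
  case False
  then have "q / (2 * p) * q \<le> (q / (2 * p))\<^sup>2 * p" using assms by blast
  with False have "q\<^sup>2 \<le> 0" by (simp add: field_simps power2_eq_square)
  then show ?thesis by simp
qed

lemma sum_sum_delta:
  "(\<Sum>p\<in>UNIV. \<Sum>q\<in>UNIV. if p = (a::'p::finite) then if q = (b::'q::finite) then x else 0 else 0) = (x::real)"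
proof -
  have "(\<Sum>q\<in>UNIV. if p = a then if q = b then x else 0 else 0) = (if p = a then x else 0)" for p
    by simp
  then show ?thesis by simp
qed

lemma linear_matrix_mult_left:
  "linear (\<lambda>X::'k::{euclidean_space,real_normed_field}^'c^'m. (A::'k^'m^'r) ** X)"
  by (rule linearI)
    (auto simp: matrix_matrix_mult_def vec_eq_iff distrib_left sum.distrib scaleR_sum_right)

lemma linear_matrix_mult_right:
  "linear (\<lambda>X::'k::{euclidean_space,real_normed_field}^'m^'r. X ** (A::'k^'c^'m))"
  by (rule linearI)
    (auto simp: matrix_matrix_mult_def vec_eq_iff distrib_right sum.distrib scaleR_sum_right)

lemma borel_measurable_matrix_mult [measurable]:
  "(\<lambda>R::'k::{euclidean_space,real_normed_field}^'c^'m. (M::'k^'m^'d) ** R) \<in> borel_measurable borel"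
  using linear_matrix_mult_left[of M]
  by (intro borel_measurable_continuous_onI linear_continuous_on) (simp add: linear_conv_bounded_linear)

lemma mat_mult_eq:
  fixes G :: "'k::{euclidean_space,real_normed_field}^'c^'d"
  shows "(mat z ** G) $ i $ j = z * G $ i $ j"
proof -
  have "(mat z ** G) $ i $ j = (\<Sum>k\<in>UNIV. if k = i then z * G $ i $ j else 0)"
    unfolding matrix_matrix_mult_def vec_lambda_beta by (rule sum.cong) (auto simp: mat_def)
  then show ?thesis by simp
qed

lemma inner_mat_1_mat_1:
  "(mat 1 :: 'k::{euclidean_space,real_normed_field}^'d^'d) \<bullet> mat 1 = CARD('d)"
proof -
  have "(mat 1 :: 'k^'d^'d) $ i $ j \<bullet> mat 1 $ i $ j = (if i = j then 1 else 0)" for i j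
    by (simp add: mat_def)
  then show ?thesis by (simp add: inner_vec_def)
qed

definition of_real_mat :: "real^'d^'d \<Rightarrow> 'k::{euclidean_space,real_normed_field}^'d^'d" where
  "of_real_mat S = (\<chi> i j. of_real (S $ i $ j))"

lemma inner_of_real_mat_diag:
  assumes "\<And>i j. i \<noteq> j \<Longrightarrow> S $ i $ j = 0"
  shows "W \<bullet> of_real_mat S = (\<Sum>i\<in>UNIV. S $ i $ i * (W $ i $ i \<bullet> 1))"
proof -
  have "W \<bullet> of_real_mat S = (\<Sum>i\<in>UNIV. \<Sum>j\<in>UNIV. if j = i then S $ i $ i * (W $ i $ i \<bullet> 1) else 0)"
    unfolding inner_vec_def of_real_mat_def
    by (intro sum.cong refl) (auto simp: assms of_real_def)
  then show ?thesis by simp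
qed

lemma continuous_on_det:
  "continuous_on A (det :: 'k::{euclidean_space,real_normed_field}^'d^'d \<Rightarrow> 'k)"
  unfolding det_def by (intro continuous_intros)

text \<open>\<open>det (I + x A)\<close> is a polynomial in \<open>x\<close> with value
  \<open>1\<close> at \<open>0\<close>, hence nonzero with finitely many roots; a root
  \<open>t\<close> other than \<open>0\<close> of \<open>det (A + t I)\<close> corresponds to
  \<open>x = 1 / t\<close>.\<close>

lemma finite_det_add_scaleR_mat_1_eq_0:
  fixes A :: "'k::{euclidean_space,real_normed_field}^'d^'d"
  shows "finite {t. det (A + t *\<^sub>R mat 1) = 0}"
proof -
  define p :: "'k poly" where "p = det (\<chi> i j. [:if i = j then 1 else 0, A $ i $ j:])"
  have p: "poly p x = det (\<chi> i j. (if i = j then 1 else 0) + x * A $ i $ j)" for x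
    by (simp add: p_def det_def poly_sum poly_prod)
  have "poly p 0 = det (mat 1 :: 'k^'d^'d)"
    unfolding p by (intro arg_cong[where f=det]) (simp add: vec_eq_iff mat_def)
  then have "p \<noteq> 0" by auto
  then have "finite {x. poly p x = 0}" by (rule poly_roots_finite)
  then have "finite ((\<lambda>t. of_real (inverse t)) -` {x. poly p x = 0})"
    by (rule finite_vimageI) (auto intro!: injI)
  moreover have "{t. det (A + t *\<^sub>R mat 1) = 0} \<subseteq> insert 0 ((\<lambda>t. of_real (inverse t)) -` {x. poly p x = 0})"
  proof
    fix t assume t: "t \<in> {t. det (A + t *\<^sub>R mat 1) = 0}"
    show "t \<in> insert 0 ((\<lambda>t. of_real (inverse t)) -` {x. poly p x = 0})"
    proof (cases "t = 0")
      case False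
      have "mat (of_real (inverse t)) ** (A + t *\<^sub>R mat 1) =
          (\<chi> i j. (if i = j then 1 else 0) + of_real (inverse t) * A $ i $ j)"
        using False unfolding vec_eq_iff mat_mult_eq vector_add_component vector_scaleR_component
        by (auto simp: mat_def scaleR_conv_of_real field_simps)
      then have "poly p (of_real (inverse t)) = det (mat (of_real (inverse t)) :: 'k^'d^'d) * det (A + t *\<^sub>R mat 1)"
        unfolding p det_mul[symmetric] by simp
      then show ?thesis using t by simp
    qed simp
  qed
  ultimately show ?thesis by (metis finite_insert finite_subset)
qed

text \<open>The two instances are the reals with the identity and the complex numbers with \<open>cnj\<close>;
  \<open>x \<bullet> 1\<close> plays the role of the real part.\<close>

locale conj_field =
  fixes cj :: "'k::{euclidean_space, real_normed_field} \<Rightarrow> 'k"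
  assumes cj_add: "cj (x + y) = cj x + cj y"
    and cj_mult: "cj (x * y) = cj x * cj y"
    and cj_cj [simp]: "cj (cj x) = x"
    and cj_of_real [simp]: "cj (of_real r) = of_real r"
    and mult_cj: "x * cj x = of_real ((norm x)\<^sup>2)"
    and inner_cj: "x \<bullet> y = (x * cj y) \<bullet> 1"
begin

lemma cj_0 [simp]: "cj 0 = 0" and cj_1 [simp]: "cj 1 = 1"
  using cj_of_real[of 0] cj_of_real[of 1] by simp_all

lemma linear_cj: "linear cj"
  by (rule linearI) (simp_all add: cj_add cj_mult scaleR_conv_of_real)

lemmas cj_sum = linear_sum[OF linear_cj]
  and cj_minus = linear_neg[OF linear_cj]

lemma norm_cj [simp]: "norm (cj x) = norm x"
proof -
  have "of_real ((norm (cj x))\<^sup>2) = (of_real ((norm x)\<^sup>2) :: 'k)"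
    using mult_cj[of x] mult_cj[of "cj x"] by (simp add: mult.commute)
  then show ?thesis by (simp only: of_real_eq_iff) simp
qed

lemma inner_mult_left_cj: "(a * x) \<bullet> y = x \<bullet> (cj a * y)"
  by (subst (1 2) inner_cj) (simp add: cj_mult mult_ac)

lemma inner_mult_right_cj: "(x * a) \<bullet> y = x \<bullet> (y * cj a)"
  by (subst (1 2) inner_cj) (simp add: cj_mult mult_ac)

lemma inner_cj_cj: "cj x \<bullet> cj y = x \<bullet> y"
  by (subst inner_cj, subst (2) inner_commute, subst (2) inner_cj) (simp add: mult.commute)

section \<open>Adjoints and unitary matrices\<close>

definition adj :: "'k^'c^'r \<Rightarrow> 'k^'r^'c" where
  "adj A = (\<chi> i j. cj (A $ j $ i))"

definition unitary :: "'k^'d^'d \<Rightarrow> bool" where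
  "unitary U \<longleftrightarrow> adj U ** U = mat 1 \<and> U ** adj U = mat 1"

lemma adj_adj [simp]: "adj (adj A) = A"
  by (simp add: adj_def vec_eq_iff)

lemma adj_mult: "adj (A ** B) = adj B ** adj A"
  by (simp add: adj_def vec_eq_iff matrix_matrix_mult_def cj_sum cj_mult mult.commute)

lemma adj_mat_1 [simp]: "adj (mat 1) = mat 1"
  by (auto simp: adj_def vec_eq_iff mat_def)

lemma linear_adj: "linear adj"
  by (rule linearI) (auto simp: adj_def vec_eq_iff cj_add linear_cmul[OF linear_cj])

lemma inner_adj_adj: "adj A \<bullet> adj B = A \<bullet> B"
  unfolding inner_vec_def adj_def by (simp add: inner_cj_cj) (rule sum.swap)

lemma inner_matrix_mult_left: "(A ** X) \<bullet> Y = X \<bullet> (adj A ** Y)"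
  for A :: "'k^'m^'r" and X :: "'k^'c^'m"
proof -
  have "(A ** X) \<bullet> Y = (\<Sum>i\<in>UNIV. \<Sum>j\<in>UNIV. \<Sum>k\<in>UNIV. X $ k $ j \<bullet> (cj (A $ i $ k) * Y $ i $ j))"
    by (simp add: inner_vec_def matrix_matrix_mult_def inner_sum_left inner_mult_left_cj)
  also have "\<dots> = (\<Sum>i\<in>UNIV. \<Sum>k\<in>UNIV. \<Sum>j\<in>UNIV. X $ k $ j \<bullet> (cj (A $ i $ k) * Y $ i $ j))"
    by (rule sum.cong[OF refl]) (rule sum.swap)
  also have "\<dots> = (\<Sum>k\<in>UNIV. \<Sum>i\<in>UNIV. \<Sum>j\<in>UNIV. X $ k $ j \<bullet> (cj (A $ i $ k) * Y $ i $ j))"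
    by (rule sum.swap)
  also have "\<dots> = (\<Sum>k\<in>UNIV. \<Sum>j\<in>UNIV. \<Sum>i\<in>UNIV. X $ k $ j \<bullet> (cj (A $ i $ k) * Y $ i $ j))"
    by (rule sum.cong[OF refl]) (rule sum.swap)
  also have "\<dots> = X \<bullet> (adj A ** Y)"
    by (simp add: inner_vec_def matrix_matrix_mult_def inner_sum_right adj_def)
  finally show ?thesis .
qed

lemma inner_matrix_mult_right: "(X ** A) \<bullet> Y = X \<bullet> (Y ** adj A)"
  for A :: "'k^'c^'m" and X :: "'k^'m^'r"
proof -
  have "(X ** A) \<bullet> Y = (adj A ** adj X) \<bullet> adj Y"
    by (simp add: inner_adj_adj flip: adj_mult)
  also have "\<dots> = adj X \<bullet> adj (Y ** adj A)"
    by (simp add: inner_matrix_mult_left adj_mult)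
  finally show ?thesis by (simp add: inner_adj_adj)
qed

lemma inner_matrix_mult_both: "(U ** X ** adj V) \<bullet> Y = X \<bullet> (adj U ** Y ** V)"
  by (subst inner_matrix_mult_right, subst inner_matrix_mult_left) (simp add: matrix_mul_assoc)

lemma inner_eq_trace: "A \<bullet> B = trace (A ** adj B) \<bullet> 1"
  by (simp add: inner_vec_def trace_def matrix_matrix_mult_def adj_def inner_sum_left
      inner_cj[symmetric])

lemma unitaryI: "adj U ** U = mat 1 \<Longrightarrow> unitary U"
  by (simp add: unitary_def matrix_left_right_inverse)

lemma unitary_mat_1 [simp]: "unitary (mat 1)"
  by (simp add: unitary_def)

lemma unitary_adj: "unitary U \<Longrightarrow> unitary (adj U)"
  by (simp add: unitary_def)

text \<open>Cancellation is stated for both bracketings of a product, so that simplification need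
  not reassociate.\<close>

lemma unitary_cancel [simp]:
  assumes "unitary U"
  shows "adj U ** U = mat 1" "U ** adj U = mat 1"
    "adj U ** (U ** X) = X" "U ** (adj U ** X) = X"
    "Y ** U ** adj U = Y" "Y ** adj U ** U = Y"
proof -
  show 1: "adj U ** U = mat 1" "U ** adj U = mat 1"
    using assms by (simp_all add: unitary_def)
  show "adj U ** (U ** X) = X" "U ** (adj U ** X) = X"
    by (simp_all only: matrix_mul_assoc 1 matrix_mul_lid)
  show "Y ** U ** adj U = Y" "Y ** adj U ** U = Y"
    by (simp_all only: matrix_mul_assoc[symmetric] 1 matrix_mul_rid)
qed

lemma unitary_mult: "unitary U \<Longrightarrow> unitary V \<Longrightarrow> unitary (U ** V)"
  by (rule unitaryI) (simp add: adj_mult flip: matrix_mul_assoc)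

lemma norm_unitary:
  assumes "unitary (U::'k^'d^'d)"
  shows "norm U = sqrt CARD('d)"
proof -
  have "U \<bullet> U = (mat 1 :: 'k^'d^'d) \<bullet> mat 1"
    using inner_matrix_mult_left[of U "mat 1" U] assms by simp
  then show ?thesis by (simp add: norm_eq_sqrt_inner inner_mat_1_mat_1)
qed

text \<open>The defining equation is closed, and all unitary matrices have the same Frobenius
  norm.\<close>

lemma compact_unitary: "compact {U::'k^'d^'d. unitary U}"
proof -
  have cj: "continuous_on UNIV cj"
    using linear_cj by (intro linear_continuous_on) (simp add: linear_conv_bounded_linear)
  have "continuous_on UNIV (\<lambda>U::'k^'d^'d. adj U ** U)"
    unfolding adj_def matrix_matrix_mult_def
    by (auto intro!: continuous_intros continuous_on_compose2[OF cj])
  then have "closed {U::'k^'d^'d. adj U ** U = mat 1}"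
    by (intro closed_Collect_eq continuous_intros) auto
  moreover have "{U::'k^'d^'d. unitary U} = {U. adj U ** U = mat 1}"
    using unitaryI unitary_def by blast
  moreover have "bounded {U::'k^'d^'d. unitary U}"
    by (rule boundedI[of _ "sqrt CARD('d)"]) (simp add: norm_unitary)
  ultimately show ?thesis by (simp add: compact_eq_bounded_closed)
qed

text \<open>\<open>Z\<close> acts as a unitary 2 by 2 matrix on the coordinates \<open>i\<close>,
  \<open>j\<close> and as the identity elsewhere; it supplies the rotations for the variational
  argument below.\<close>

lemma unitary_2x2:
  fixes i j :: "'d::finite" and a b c e :: 'k
  assumes ij: "i \<noteq> j"
    and col_i: "cj a * a + cj c * c = 1" and col_j: "cj b * b + cj e * e = 1"
    and orth: "cj a * b + cj c * e = 0"
  defines "Z \<equiv> (\<chi> p q. if p = i \<and> q = i then a else if p = i \<and> q = j then b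
      else if p = j \<and> q = i then c else if p = j \<and> q = j then e else if p = q then 1 else 0)"
  shows "unitary Z"
proof (rule unitaryI)
  have orth': "cj b * a + cj e * c = 0"
    using arg_cong[OF orth, of cj] by (simp add: cj_add cj_mult mult.commute)
  have sum_ij: "(\<Sum>k\<in>UNIV. f k) = f i + f j + (\<Sum>k\<in>UNIV - {i, j}. f k)" for f :: "'d \<Rightarrow> 'k"
  proof -
    have "UNIV - {i, j} = UNIV - {i} - {j}" by auto
    then show ?thesis
      using ij by (simp add: sum.remove[of UNIV i] sum.remove[of "UNIV - {i}" j] add.assoc)
  qed
  have "(\<Sum>k\<in>UNIV. cj (Z $ k $ p) * Z $ k $ q) = (if p = q then 1 else 0)" for p q
  proof -
    have "(\<Sum>k\<in>UNIV - {i, j}. cj (Z $ k $ p) * Z $ k $ q)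
        = (\<Sum>k\<in>UNIV - {i, j}. if k = p then (if p = q then 1 else 0) else 0)"
      by (rule sum.cong) (auto simp: Z_def)
    also have "\<dots> = (if p \<noteq> i \<and> p \<noteq> j \<and> p = q then 1 else 0)"
      by (subst sum.delta) auto
    finally show ?thesis
      using ij col_i col_j orth orth' by (subst sum_ij) (auto simp: Z_def)
  qed
  then show "adj Z ** Z = mat 1"
    by (simp add: vec_eq_iff adj_def matrix_matrix_mult_def mat_def)
qed

text \<open>First-order optimality at the identity, tested against rotations in coordinate planes.\<close>

lemma unitary_maximal_mat_1:
  fixes B :: "'k^'d^'d"
  assumes max: "\<And>Z. unitary Z \<Longrightarrow> Z \<bullet> B \<le> mat 1 \<bullet> B"
  shows "B $ i $ i = of_real (norm (B $ i $ i))"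
    and "i \<noteq> j \<Longrightarrow> B $ i $ j = cj (B $ j $ i)"
proof -
  show "B $ i $ i = of_real (norm (B $ i $ i))"
  proof (cases "B $ i $ i = 0")
    case False
    \<comment> \<open>\<open>w\<close> is the phase of the diagonal entry. Multiplying the
      \<open>i\<close>-th coordinate by it gains the norm of the entry minus its real part, which by
      maximality cannot be positive.\<close>
    define w where "w = B $ i $ i / of_real (norm (B $ i $ i))"
    have w: "norm w = 1" using False by (simp add: w_def norm_divide)
    have wB: "w \<bullet> B $ i $ i = norm (B $ i $ i)"
    proof -
      have "w = (1 / norm (B $ i $ i)) *\<^sub>R B $ i $ i"
        by (simp add: w_def scaleR_conv_of_real divide_inverse mult.commute of_real_inverse)
      then show ?thesis using False by (simp add: power2_norm_eq_inner[symmetric] power2_eq_square)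
    qed
    define Z :: "'k^'d^'d" where "Z = (\<chi> p q. if p = q then if p = i then w else 1 else 0)"
    have ww: "cj w * w = 1" using mult_cj[of w] w by (simp add: mult.commute)
    have "(\<Sum>k\<in>UNIV. cj (Z $ k $ p) * Z $ k $ q) = (if p = q then 1 else 0)" for p q
    proof -
      have "(\<Sum>k\<in>UNIV. cj (Z $ k $ p) * Z $ k $ q) = (\<Sum>k\<in>UNIV. if k = p then (if p = q then 1 else 0) else 0)"
        by (rule sum.cong) (auto simp: Z_def ww)
      then show ?thesis by simp
    qed
    then have "unitary Z"
      by (intro unitaryI) (simp add: vec_eq_iff adj_def matrix_matrix_mult_def mat_def)
    then have "(Z - mat 1) \<bullet> B \<le> 0" using max[of Z] by (simp add: inner_diff_left)
    also have "(Z - mat 1) \<bullet> B = (\<Sum>p\<in>UNIV. \<Sum>q\<in>UNIV. if p = i \<and> q = i then (w - 1) \<bullet> B $ i $ i else 0)"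
      unfolding inner_vec_def by (intro sum.cong) (auto simp: Z_def mat_def)
    also have "\<dots> = (\<Sum>p\<in>UNIV. if p = i then (w - 1) \<bullet> B $ i $ i else 0)"
      by (intro sum.cong) auto
    also have "\<dots> = norm (B $ i $ i) - B $ i $ i \<bullet> 1"
      by (simp add: inner_diff_left wB inner_commute)
    finally show ?thesis by (intro eq_of_real_norm) simp
  qed simp
  show "B $ i $ j = cj (B $ j $ i)" if ij: "i \<noteq> j"
  proof -
    \<comment> \<open>\<open>D\<close> measures the failure of \<open>B\<close> to be Hermitian at
      this entry; it is shown to be orthogonal to every unit \<open>w\<close>.\<close>
    define D where "D = B $ i $ j - cj (B $ j $ i)"
    have "w \<bullet> D = 0" if w: "norm w = 1" for w
    proof (rule eq_0_if_linear_le_quadratic)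
      fix t :: real
      \<comment> \<open>Rational parametrisation of the circle: \<open>c - 1\<close> and
        \<open>s\<close> are \<open>- t^2\<close> and \<open>t\<close> times the common factor
        \<open>2 / (1 + t^2)\<close>, so maximality bounds a linear term in \<open>t\<close> by a
        quadratic one.\<close>
      define c where "c = (1 - t\<^sup>2) / (1 + t\<^sup>2)"
      define s where "s = 2 * t / (1 + t\<^sup>2)"
      have pos: "1 + t\<^sup>2 > 0" by (simp add: add_pos_nonneg)
      have cs: "c\<^sup>2 + s\<^sup>2 = 1"
        using pos unfolding c_def s_def by (simp add: divide_simps) (simp add: power2_eq_square algebra_simps)
      have ww: "cj w * w = 1" "w * cj w = 1" using mult_cj[of w] w by (simp_all add: mult.commute)
      have cs': "of_real c * of_real c + of_real s * of_real s = (1::'k)"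
        using arg_cong[OF cs, of "of_real :: real \<Rightarrow> 'k"] by (simp add: power2_eq_square)
      define Z :: "'k^'d^'d" where "Z = (\<chi> p q. if p = i \<and> q = i then of_real c
        else if p = i \<and> q = j then of_real s * w
        else if p = j \<and> q = i then - of_real s * cj w
        else if p = j \<and> q = j then of_real c else if p = q then 1 else 0)"
      have "unitary Z"
        unfolding Z_def
      proof (rule unitary_2x2[OF ij])
        have "cj (of_real c) * of_real c + cj (- of_real s * cj w) * (- of_real s * cj w)
          = of_real c * of_real c + of_real s * of_real s * (w * cj w)"
          by (simp add: cj_mult cj_minus algebra_simps)
        then show "cj (of_real c) * of_real c + cj (- of_real s * cj w) * (- of_real s * cj w) = 1"
          by (simp add: ww cs')
        have "cj (of_real s * w) * (of_real s * w) + cj (of_real c) * of_real c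
          = of_real c * of_real c + of_real s * of_real s * (w * cj w)"
          by (simp add: cj_mult cj_minus algebra_simps)
        then show "cj (of_real s * w) * (of_real s * w) + cj (of_real c) * of_real c = 1"
          by (simp add: ww cs')
        show "cj (of_real c) * (of_real s * w) + cj (- of_real s * cj w) * of_real c = 0"
          by (simp add: cj_mult cj_minus algebra_simps)
      qed
      then have "(Z - mat 1) \<bullet> B \<le> 0" using max[of Z] by (simp add: inner_diff_left)
      also have "(Z - mat 1) \<bullet> B = (\<Sum>p\<in>UNIV. \<Sum>q\<in>UNIV.
          (if p = i then if q = i then (c - 1) * (1 \<bullet> B $ i $ i) else 0 else 0)
        + (if p = i then if q = j then s * (w \<bullet> B $ i $ j) else 0 else 0)
        + (if p = j then if q = i then - s * (cj w \<bullet> B $ j $ i) else 0 else 0)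
        + (if p = j then if q = j then (c - 1) * (1 \<bullet> B $ j $ j) else 0 else 0))"
        unfolding inner_vec_def using ij
        by (intro sum.cong)
          (auto simp: Z_def mat_def inner_diff_left of_real_def algebra_simps)
      also have "\<dots> = (c - 1) * (1 \<bullet> B $ i $ i) + s * (w \<bullet> B $ i $ j) - s * (cj w \<bullet> B $ j $ i)
          + (c - 1) * (1 \<bullet> B $ j $ j)"
        by (simp add: sum.distrib sum_sum_delta)
      also have "cj w \<bullet> B $ j $ i = w \<bullet> cj (B $ j $ i)"
        using inner_cj_cj[of w "cj (B $ j $ i)"] by simp
      also have "(c - 1) * (1 \<bullet> B $ i $ i) + s * (w \<bullet> B $ i $ j) - s * (w \<bullet> cj (B $ j $ i)) + (c - 1) * (1 \<bullet> B $ j $ j)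
        = (2 / (1 + t\<^sup>2)) * (t * (w \<bullet> D) - t\<^sup>2 * (1 \<bullet> B $ i $ i + 1 \<bullet> B $ j $ j))"
      proof -
        have "c - 1 = (2 / (1 + t\<^sup>2)) * (- t\<^sup>2)" "s = (2 / (1 + t\<^sup>2)) * t"
          using pos by (simp_all add: c_def s_def field_simps)
        then show ?thesis by (simp only:) (simp add: D_def inner_diff_right algebra_simps)
      qed
      finally show "t * (w \<bullet> D) \<le> t\<^sup>2 * (1 \<bullet> B $ i $ i + 1 \<bullet> B $ j $ j)"
        using pos by (simp add: mult_le_0_iff divide_le_0_iff)
    qed
    \<comment> \<open>Testing with the direction of \<open>D\<close> itself gives the norm of
      \<open>D\<close>.\<close>
    from this[of "sgn D"] have "D = 0"
      by (cases "D = 0") (auto simp: norm_sgn sgn_div_norm)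
    then show ?thesis by (simp add: D_def)
  qed
qed

subsection \<open>Singular values and the polar factor\<close>

text \<open>\<open>S\<close> is a real matrix over either field, embedded by
  \<open>of_real_mat\<close>; this matches the conditions under the descriptions in
  \<open>sv_sum_real\<close> and \<open>sv_sum_cplx\<close>.\<close>

definition is_svd :: "'k^'d^'d \<Rightarrow> 'k^'d^'d \<Rightarrow> real^'d^'d \<Rightarrow> 'k^'d^'d \<Rightarrow> bool" where
  "is_svd G U S V \<longleftrightarrow> unitary U \<and> unitary V \<and> (\<forall>i j. i \<noteq> j \<longrightarrow> S $ i $ j = 0) \<and>
     (\<forall>i. 0 \<le> S $ i $ i) \<and> G = U ** of_real_mat S ** adj V"

text \<open>The factors are found by maximising the trace of \<open>U\<^sup>H G V\<close> with distinct positive weights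
  on the diagonal: optimality in \<open>U\<close> and in \<open>V\<close> makes \<open>A C\<close> and \<open>C A\<close> Hermitian for
  \<open>A = U\<^sup>H G V\<close> and the weight matrix \<open>C\<close>, and then \<open>A\<close> is diagonal.\<close>

lemma svd_exists:
  fixes G :: "'k^'d^'d"
  obtains U S V where "is_svd G U S V"
proof -
  obtain f :: "'d \<Rightarrow> nat" where f: "inj f"
    using finite_imp_inj_to_nat_seg[of "UNIV :: 'd set"] by auto
  define c where "c i = real (f i) + 1" for i
  have c_pos: "c i > 0" for i by (simp add: c_def)
  have c_inj: "c i = c j \<Longrightarrow> i = j" for i j using f by (simp add: c_def inj_eq)
  define C :: "'k^'d^'d" where "C = (\<chi> i j. if i = j then of_real (c i) else 0)"
  have adj_C: "adj C = C" by (auto simp: adj_def C_def vec_eq_iff)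
  have MC: "(M ** C) $ i $ j = of_real (c j) * M $ i $ j" for M :: "'k^'d^'d" and i j
    by (simp add: matrix_matrix_mult_def C_def if_distrib[of "\<lambda>x. _ * x"] mult.commute cong: if_cong)
  have CM: "(C ** M) $ i $ j = of_real (c i) * M $ i $ j" for M :: "'k^'d^'d" and i j
  proof -
    have "(C ** M) $ i $ j = (\<Sum>k\<in>UNIV. if k = i then of_real (c i) * M $ i $ j else 0)"
      unfolding matrix_matrix_mult_def vec_lambda_beta by (rule sum.cong) (auto simp: C_def)
    then show ?thesis by simp
  qed
  let ?T = "{U::'k^'d^'d. unitary U}"
  have "continuous_on (?T \<times> ?T) (\<lambda>p. (fst p ** C ** adj (snd p)) \<bullet> G)"
  proof -
    have "continuous_on UNIV cj"
      using linear_cj by (intro linear_continuous_on) (simp add: linear_conv_bounded_linear)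
    note cj = continuous_on_compose2[OF this]
    show ?thesis
      unfolding adj_def matrix_matrix_mult_def
      by (auto intro!: continuous_intros cj)
  qed
  moreover have "?T \<times> ?T \<noteq> {}" using unitary_mat_1 by blast
  ultimately have "\<exists>p\<in>?T \<times> ?T. \<forall>q\<in>?T \<times> ?T.
      (fst q ** C ** adj (snd q)) \<bullet> G \<le> (fst p ** C ** adj (snd p)) \<bullet> G"
    by (intro continuous_attains_sup compact_Times compact_unitary)
  then obtain p where p: "p \<in> ?T \<times> ?T"
      "\<And>q. q \<in> ?T \<times> ?T \<Longrightarrow> (fst q ** C ** adj (snd q)) \<bullet> G \<le> (fst p ** C ** adj (snd p)) \<bullet> G"
    by blast
  define U V where "U = fst p" and "V = snd p"
  have U [simp]: "unitary U" and V [simp]: "unitary V" using p(1) by (auto simp: U_def V_def)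
  define A where "A = adj U ** G ** V"
  have G: "G = U ** A ** adj V" by (simp add: A_def matrix_mul_assoc[symmetric])
  \<comment> \<open>Perturbing \<open>U\<close> to \<open>U ** Z1\<close> and \<open>V\<close> to
    \<open>V ** adj Z2\<close> moves the maximum to the identity, where
    \<open>unitary_maximal_mat_1\<close> applies.\<close>
  have max: "(Z1 ** C ** Z2) \<bullet> A \<le> C \<bullet> A" if "unitary Z1" "unitary Z2" for Z1 Z2
  proof -
    have *: "(U ** X ** adj V) \<bullet> G = X \<bullet> A" for X
      unfolding A_def by (rule inner_matrix_mult_both)
    have "((U ** Z1) ** C ** adj (V ** adj Z2)) \<bullet> G \<le> (U ** C ** adj V) \<bullet> G"
      using p(2)[of "(U ** Z1, V ** adj Z2)"] that
      by (simp add: U_def[symmetric] V_def[symmetric] unitary_mult unitary_adj)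
    moreover have "(U ** Z1) ** C ** adj (V ** adj Z2) = U ** (Z1 ** C ** Z2) ** adj V"
      by (simp add: adj_mult matrix_mul_assoc)
    ultimately show ?thesis by (simp add: *)
  qed
  have AC: "Z \<bullet> (A ** C) \<le> mat 1 \<bullet> (A ** C)" if "unitary Z" for Z
    using max[OF that unitary_mat_1] inner_matrix_mult_right[of _ C A] by (metis adj_C matrix_mul_lid matrix_mul_rid)
  have CA: "Z \<bullet> (C ** A) \<le> mat 1 \<bullet> (C ** A)" if "unitary Z" for Z
    using max[OF unitary_mat_1 that] inner_matrix_mult_left[of C _ A] by (metis adj_C matrix_mul_lid matrix_mul_rid)
  have off: "A $ i $ j = 0" if ij: "i \<noteq> j" for i j
  proof -
    have 1: "of_real (c j) * A $ i $ j = of_real (c i) * cj (A $ j $ i)"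
      using unitary_maximal_mat_1(2)[OF AC ij] by (simp add: MC cj_mult)
    have 2: "of_real (c i) * A $ i $ j = of_real (c j) * cj (A $ j $ i)"
      using unitary_maximal_mat_1(2)[OF CA ij] by (simp add: CM cj_mult)
    \<comment> \<open>Both sides equal \<open>c i * c j\<close> times the conjugate of
      \<open>A $ j $ i\<close>; since the squares of distinct positive weights differ, the entry
      vanishes.\<close>
    have "of_real (c j) * (of_real (c j) * A $ i $ j) = of_real (c i) * (of_real (c i) * A $ i $ j)"
      unfolding 1 2 by (simp add: mult_ac)
    then have "of_real (c j * c j - c i * c i) * A $ i $ j = 0"
      by (simp add: algebra_simps)
    moreover have "c j * c j - c i * c i \<noteq> 0"
    proof
      assume "c j * c j - c i * c i = 0"
      then have "(c j)\<^sup>2 = (c i)\<^sup>2" by (simp add: power2_eq_square)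
      then have "c j = c i" using c_pos[of i] c_pos[of j] by (simp add: power2_eq_iff_nonneg)
      then show False using c_inj ij by metis
    qed
    ultimately show ?thesis by (metis mult_eq_0_iff of_real_eq_0_iff)
  qed
  have diag: "A $ i $ i = of_real (norm (A $ i $ i))" for i
  proof -
    have "of_real (c i) * A $ i $ i = of_real (c i) * of_real (norm (A $ i $ i))"
      using unitary_maximal_mat_1(1)[OF AC, of i] c_pos[of i] by (simp add: MC norm_mult)
    then show ?thesis using c_pos[of i] by simp
  qed
  define S :: "real^'d^'d" where "S = (\<chi> i j. norm (A $ i $ j))"
  have "A $ i $ j = of_real_mat S $ i $ j" for i j
    by (cases "i = j") (simp_all add: of_real_mat_def S_def off diag[symmetric])
  then have "A = of_real_mat S" by (simp add: vec_eq_iff)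
  then have "is_svd G U S V"
    using G by (simp add: is_svd_def S_def off)
  then show ?thesis by (rule that)
qed

text \<open>Maximising over unitary \<open>Z\<close> is thereby reduced to bounding the diagonal of
  the unitary matrix \<open>adj U ** Z ** V\<close>, with the singular values as weights.\<close>

lemma inner_svd:
  assumes "is_svd G U S V"
  shows "Z \<bullet> G = (\<Sum>i\<in>UNIV. S $ i $ i * ((adj U ** Z ** V) $ i $ i \<bullet> 1))"
proof -
  have "Z \<bullet> G = G \<bullet> Z" by (rule inner_commute)
  also have "\<dots> = of_real_mat S \<bullet> (adj U ** Z ** V)"
    using assms inner_matrix_mult_both[of U "of_real_mat S" V Z] by (simp add: is_svd_def)
  also have "\<dots> = (\<Sum>i\<in>UNIV. S $ i $ i * ((adj U ** Z ** V) $ i $ i \<bullet> 1))"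
    using assms by (subst inner_commute, subst inner_of_real_mat_diag) (auto simp: is_svd_def)
  finally show ?thesis .
qed

text \<open>Each row of a unitary matrix is a unit vector.\<close>

lemma unitary_diag_le_1:
  assumes "unitary W"
  shows "W $ i $ i \<bullet> 1 \<le> 1"
proof -
  have "(W ** adj W) $ i $ i = 1" using assms by (simp add: mat_def)
  then have "(\<Sum>k\<in>UNIV. W $ i $ k * cj (W $ i $ k)) \<bullet> 1 = 1"
    by (simp add: matrix_matrix_mult_def adj_def)
  then have "W $ i \<bullet> W $ i = 1"
    by (simp add: inner_sum_left inner_cj[symmetric] inner_vec_def)
  then have "norm (W $ i) = 1" by (simp add: norm_eq_1)
  then have "norm (W $ i $ i) \<le> 1" using Finite_Cartesian_Product.norm_nth_le[of "W $ i" i] by simp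
  then show ?thesis using norm_cauchy_schwarz[of "W $ i $ i" 1] by simp
qed

lemma inner_svd_le:
  assumes svd: "is_svd G U S V" and Z: "unitary Z"
  shows "Z \<bullet> G \<le> trace S"
proof -
  have "unitary (adj U ** Z ** V)"
    using svd Z by (simp add: is_svd_def unitary_mult unitary_adj)
  note W = unitary_diag_le_1[OF this]
  have "S $ i $ i * ((adj U ** Z ** V) $ i $ i \<bullet> 1) \<le> S $ i $ i" for i
    using svd W[of i] by (intro mult_left_le) (simp_all add: is_svd_def)
  then show ?thesis unfolding inner_svd[OF svd] trace_def by (intro sum_mono) simp
qed

lemma inner_svd_eq:
  assumes svd: "is_svd G U S V"
  shows "unitary (U ** adj V)" "(U ** adj V) \<bullet> G = trace S"
proof -
  show "unitary (U ** adj V)"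
    using svd by (simp add: is_svd_def unitary_mult unitary_adj)
  have "adj U ** (U ** adj V) ** V = mat 1" using svd by (simp add: is_svd_def)
  then show "(U ** adj V) \<bullet> G = trace S"
    by (simp add: inner_svd[OF svd] trace_def mat_def)
qed

text \<open>For invertible \<open>G\<close> all singular values are positive, so equality forces
  every diagonal entry of \<open>W = adj U ** Z ** V\<close> to have real part \<open>1\<close>. As
  \<open>W\<close> and the identity both have squared norm \<open>d\<close>, their difference has
  squared norm \<open>d - 2 d + d = 0\<close>.\<close>

lemma inner_svd_eq_imp:
  fixes G :: "'k^'d^'d"
  assumes svd: "is_svd G U S V" and Z: "unitary Z" and eq: "Z \<bullet> G = trace S" and G: "det G \<noteq> 0"
  shows "Z = U ** adj V"
proof -
  have UV: "unitary U" "unitary V" using svd by (auto simp: is_svd_def)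
  define W where "W = adj U ** Z ** V"
  have W: "unitary W" using UV Z by (simp add: W_def unitary_mult unitary_adj)
  have "det (of_real_mat S :: 'k^'d^'d) \<noteq> 0"
    using G svd by (auto simp: is_svd_def det_mul)
  moreover have "det (of_real_mat S :: 'k^'d^'d) = (\<Prod>i\<in>UNIV. of_real (S $ i $ i))"
    using svd by (subst det_diagonal) (auto simp: is_svd_def of_real_mat_def)
  ultimately have S_pos: "S $ i $ i > 0" for i
    using svd by (auto simp: is_svd_def less_le)
  have "(\<Sum>i\<in>UNIV. S $ i $ i * (1 - W $ i $ i \<bullet> 1)) = 0"
    using eq unfolding inner_svd[OF svd] by (simp add: W_def trace_def right_diff_distrib sum_subtractf)
  then have "S $ i $ i * (1 - W $ i $ i \<bullet> 1) = 0" for i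
    using S_pos unitary_diag_le_1[OF W]
    by (subst (asm) sum_nonneg_eq_0_iff) (auto simp: less_imp_le)
  then have W1: "W $ i $ i \<bullet> 1 = 1" for i using S_pos[of i] by (metis diff_eq_diff_eq diff_self less_irrefl mult_eq_0_iff right_minus_eq)
  have "W \<bullet> mat 1 = CARD('d)"
  proof -
    have "of_real_mat (mat 1) = (mat 1 :: 'k^'d^'d)" by (auto simp: of_real_mat_def mat_def vec_eq_iff)
    then show ?thesis
      using inner_of_real_mat_diag[of "mat 1" W] by simp (simp add: mat_def W1)
  qed
  moreover have "W \<bullet> W = CARD('d)"
    using norm_unitary[OF W] by (simp add: norm_eq_sqrt_inner)
  ultimately have "(W - mat 1) \<bullet> (W - mat 1) = 0"
    by (simp add: inner_diff inner_mat_1_mat_1 inner_commute[of "mat 1" W])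
  then have "W = mat 1" by simp
  then have "U ** W ** adj V = U ** adj V" by simp
  then show ?thesis using UV by (simp add: W_def matrix_mul_assoc[symmetric])
qed

section \<open>The polar factor: existence, uniqueness, measurability and equivariance\<close>

definition polar :: "'k^'d^'d \<Rightarrow> 'k^'d^'d" where
  "polar X = (SOME Z. unitary Z \<and> (\<forall>Z'. unitary Z' \<longrightarrow> norm (Z - X) \<le> norm (Z' - X)))"

text \<open>All unitary matrices have the same norm, so being nearest to \<open>X\<close> means
  having the largest inner product with \<open>X\<close>.\<close>

lemma norm_unitary_diff_le_iff:
  assumes "unitary Z" "unitary Z'"
  shows "norm (Z - X) \<le> norm (Z' - X) \<longleftrightarrow> Z' \<bullet> X \<le> Z \<bullet> X"
proof -
  have "Z \<bullet> Z = Z' \<bullet> Z'"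
    using norm_unitary[OF assms(1)] norm_unitary[OF assms(2)] by (simp add: norm_eq_sqrt_inner)
  then show ?thesis
    by (simp add: norm_le inner_diff inner_commute)
qed

lemma polar:
  shows unitary_polar: "unitary (polar G)"
    and polar_maximal: "unitary Z \<Longrightarrow> Z \<bullet> G \<le> polar G \<bullet> G"
proof -
  obtain U S V where svd: "is_svd G U S V" by (rule svd_exists)
  have "\<exists>Z. unitary Z \<and> (\<forall>Z'. unitary Z' \<longrightarrow> norm (Z - G) \<le> norm (Z' - G))"
    using inner_svd_eq[OF svd] inner_svd_le[OF svd]
    by (intro exI[of _ "U ** adj V"]) (auto simp: norm_unitary_diff_le_iff)
  from someI_ex[OF this, folded polar_def]
  show "unitary (polar G)" "unitary Z \<Longrightarrow> Z \<bullet> G \<le> polar G \<bullet> G"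
    by (auto simp: norm_unitary_diff_le_iff)
qed

lemma polar_inner_svd:
  assumes "is_svd G U S V"
  shows "polar G \<bullet> G = trace S"
  using inner_svd_eq[OF assms] inner_svd_le[OF assms unitary_polar[of G]] polar_maximal[of "U ** adj V" G]
  by simp

text \<open>Every maximiser attains the trace of \<open>S\<close>, and for invertible
  \<open>G\<close> only \<open>U ** adj V\<close> does.\<close>

lemma polar_unique:
  assumes "det G \<noteq> 0" "unitary Z" "\<And>Z'. unitary Z' \<Longrightarrow> Z' \<bullet> G \<le> Z \<bullet> G"
  shows "polar G = Z"
proof -
  obtain U S V where svd: "is_svd G U S V" by (rule svd_exists)
  have "Z \<bullet> G = trace S"
    using assms(3)[OF unitary_polar[of G]] polar_maximal[OF assms(2), of G] polar_inner_svd[OF svd] by simp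
  then show ?thesis
    using inner_svd_eq_imp[OF svd] polar_inner_svd[OF svd] unitary_polar assms by metis
qed

definition sv_sum :: "'k^'d^'d \<Rightarrow> real" where
  "sv_sum G = (THE s. \<exists>U S V. is_svd G U S V \<and> s = trace S)"

text \<open>Every singular value decomposition has trace \<open>polar G \<bullet> G\<close>, which
  does not involve the decomposition; hence the description is well defined.\<close>

lemma sv_sum_eq_polar: "sv_sum G = polar G \<bullet> G"
  unfolding sv_sum_def
proof (rule the_equality)
  show "\<exists>U S V. is_svd G U S V \<and> polar G \<bullet> G = trace S"
    using svd_exists polar_inner_svd by metis
qed (auto dest: polar_inner_svd)

text \<open>A map into a compact set is continuous if its graph is closed. By uniqueness the graph
  is cut out by the closed conditions \<open>Z' \<bullet> G \<le> Z \<bullet> G\<close>, one for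
  each unitary \<open>Z'\<close>.\<close>

lemma continuous_on_polar: "continuous_on {G::'k^'d^'d. det G \<noteq> 0} polar"
proof -
  let ?S = "{G::'k^'d^'d. det G \<noteq> 0}" and ?T = "{Z::'k^'d^'d. unitary Z}"
  have graph: "(\<lambda>G. (G, polar G)) ` ?S = (?S \<times> ?T) \<inter> (\<Inter>Z'\<in>?T. {p. Z' \<bullet> fst p \<le> snd p \<bullet> fst p})"
    using polar_unique by (fastforce simp: unitary_polar polar_maximal)
  have "closed (\<Inter>Z'\<in>?T. {p :: ('k^'d^'d) \<times> ('k^'d^'d). Z' \<bullet> fst p \<le> snd p \<bullet> fst p})"
    by (intro closed_INT ballI closed_Collect_le continuous_intros)
  then have "closedin (top_of_set (?S \<times> ?T)) ((\<lambda>G. (G, polar G)) ` ?S)"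
    unfolding graph by (rule closedin_closed_Int)
  then show ?thesis
    by (subst continuous_closed_graph_eq[OF compact_unitary]) (auto simp: unitary_polar)
qed

text \<open>Where \<open>det G = 0\<close> the polar factor is an arbitrary choice; replacing it by \<open>0\<close> there
  gives a Borel map that is equivariant everywhere.\<close>

definition polar0 :: "'k^'d^'d \<Rightarrow> 'k^'d^'d" where
  "polar0 G = (if det G = 0 then 0 else polar G)"

lemma borel_measurable_polar0: "polar0 \<in> borel_measurable borel"
proof -
  have "open {G::'k^'d^'d. det G \<noteq> 0}"
    by (intro open_Collect_neq continuous_on_det continuous_intros)
  then have "(\<lambda>G::'k^'d^'d. indicator {G. det G \<noteq> 0} G *\<^sub>R polar G) \<in> borel_measurable borel"
    using continuous_on_polar by (intro borel_measurable_continuous_on_indicator borel_open)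
  also have "(\<lambda>G::'k^'d^'d. indicator {G. det G \<noteq> 0} G *\<^sub>R polar G) = polar0"
    by (auto simp: polar0_def)
  finally show ?thesis .
qed

lemma norm_polar0_le: "norm (polar0 (G::'k^'d^'d)) \<le> sqrt CARD('d)"
  by (simp add: polar0_def norm_unitary unitary_polar)

lemma det_unitary_nonzero: "unitary U \<Longrightarrow> det U \<noteq> 0"
  by (metis det_I det_mul mult_zero_left unitary_cancel(2) zero_neq_one)

text \<open>Moving \<open>Q\<close> across the inner product permutes the unitary competitors, so
  \<open>Q\<close> carries the maximiser for \<open>G\<close> to the one for
  \<open>Q ** G\<close>.\<close>

lemma polar0_unitary_mult:
  fixes Q G :: "'k^'d^'d"
  assumes Q: "unitary Q"
  shows "polar0 (Q ** G) = Q ** polar0 G"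
proof (cases "det G = 0")
  case True
  then show ?thesis by (simp add: polar0_def det_mul linear_0[OF linear_matrix_mult_left])
next
  case False
  have "polar (Q ** G) = Q ** polar G"
  proof (rule polar_unique)
    show "det (Q ** G) \<noteq> 0" using False det_unitary_nonzero[OF Q] by (simp add: det_mul)
    show "unitary (Q ** polar G)" by (intro unitary_mult Q unitary_polar)
    fix Z :: "'k^'d^'d" assume Z: "unitary Z"
    have "Z \<bullet> (Q ** G) = (adj Q ** Z) \<bullet> G" by (simp add: inner_matrix_mult_left)
    also have "\<dots> \<le> polar G \<bullet> G"
      by (intro polar_maximal unitary_mult unitary_adj Q Z)
    also have "\<dots> = (Q ** polar G) \<bullet> (Q ** G)" using Q by (simp add: inner_matrix_mult_left)
    finally show "Z \<bullet> (Q ** G) \<le> (Q ** polar G) \<bullet> (Q ** G)" .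
  qed
  then show ?thesis
    using False det_unitary_nonzero[OF Q] by (simp add: polar0_def det_mul)
qed

lemma inner_mat_mult: "A \<bullet> (mat z ** B) = trace (A ** adj B) \<bullet> z"
proof -
  have "A \<bullet> (mat z ** B) = (\<Sum>i\<in>UNIV. \<Sum>j\<in>UNIV. (A $ i $ j * cj (B $ i $ j)) \<bullet> z)"
    by (simp add: inner_vec_def mat_mult_eq inner_mult_right_cj)
  then show ?thesis
    by (simp add: trace_def matrix_matrix_mult_def adj_def inner_sum_left)
qed

text \<open>The trace of \<open>P G\<^sup>H\<close> is real for the polar factor \<open>P\<close>: otherwise a phase factor
  would increase \<open>P \<bullet> G\<close>.\<close>

lemma polar0_inner_mat_mult:
  fixes G :: "'k^'d^'d"
  shows "polar0 G \<bullet> (mat z ** G) = (1 \<bullet> z) * (polar0 G \<bullet> G)"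
proof (cases "det G = 0")
  case False
  define \<tau> where "\<tau> = trace (polar G ** adj G)"
  have P: "polar G \<bullet> (mat w ** G) = \<tau> \<bullet> w" for w
    by (simp add: \<tau>_def inner_mat_mult)
  have "\<tau> = of_real (norm \<tau>)"
  proof (cases "\<tau> = 0")
    case False
    define w where "w = sgn \<tau>"
    have w: "norm w = 1" using False by (simp add: w_def norm_sgn)
    have adj_w: "adj (mat (cj w) :: 'k^'d^'d) = mat w" by (auto simp: adj_def mat_def vec_eq_iff)
    have "adj (mat (cj w) :: 'k^'d^'d) ** mat (cj w) = mat 1"
      using mult_cj[of w] w unfolding adj_w vec_eq_iff mat_mult_eq by (auto simp: mat_def)
    then have u: "unitary (mat (cj w) ** polar G)"
      by (intro unitary_mult unitary_polar unitaryI)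
    have "\<tau> \<bullet> w = (mat (cj w) ** polar G) \<bullet> G"
      by (simp add: inner_matrix_mult_left P adj_w)
    also have "\<dots> \<le> polar G \<bullet> G" by (rule polar_maximal[OF u])
    also have "\<dots> = \<tau> \<bullet> 1" using P[of 1] by simp
    finally have "norm \<tau> \<le> \<tau> \<bullet> 1"
      using False by (simp add: w_def sgn_div_norm power2_norm_eq_inner[symmetric] power2_eq_square field_simps)
    then show ?thesis by (rule eq_of_real_norm)
  qed simp
  then have "\<tau> \<bullet> z = norm \<tau> * (1 \<bullet> z)" "\<tau> \<bullet> 1 = norm \<tau>"
    by (metis inner_of_real, metis inner_of_real inner_1_1 mult.right_neutral)
  then show ?thesis using False P[of z] P[of 1] by (simp add: polar0_def)
qed (simp add: polar0_def)

subsection \<open>Gaussian integrals of equivariant maps\<close>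

text \<open>Translating by \<open>t M\<^sup>H\<close> replaces \<open>M R\<close> by \<open>M R + t I\<close>, which is singular for only finitely
  many \<open>t\<close>; now average over \<open>t\<close>.\<close>

lemma AE_det_mult_nonzero:
  fixes M :: "'k^'m^'d"
  assumes M: "M ** adj M = mat 1"
  shows "AE R in lborel. det (M ** R) \<noteq> 0"
proof -
  have lin: "continuous_on UNIV (\<lambda>R::'k^'d^'m. M ** R)"
    using linear_matrix_mult_left[of M] by (intro linear_continuous_on) (simp add: linear_conv_bounded_linear)
  have cont: "continuous_on UNIV (\<lambda>R::'k^'d^'m. det (M ** R))"
    by (rule continuous_on_compose2[OF continuous_on_det[of UNIV] lin]) auto
  define N where "N = {R::'k^'d^'m. det (M ** R) = 0}"
  have N [measurable]: "N \<in> sets borel"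
    unfolding N_def by (intro borel_closed closed_Collect_eq cont continuous_intros)
  have shift: "emeasure lborel N = (\<integral>\<^sup>+R. indicator N (R + t *\<^sub>R adj M) \<partial>lborel)" for t
    using nn_integral_lborel_shift[of "indicator N" "t *\<^sub>R adj M"] by simp
  \<comment> \<open>The interval has length one, so inserting its indicator changes nothing and
    makes room for a translate depending on \<open>t\<close>.\<close>
  have "emeasure lborel N = (\<integral>\<^sup>+t. emeasure lborel N * indicator {0..1::real} t \<partial>lborel)"
    by (simp add: nn_integral_cmult)
  also have "\<dots> = (\<integral>\<^sup>+t. (\<integral>\<^sup>+R. indicator {0..1::real} t * indicator N (R + t *\<^sub>R adj M) \<partial>lborel) \<partial>lborel)"
  proof (rule nn_integral_cong)
    fix t :: real
    show "emeasure lborel N * indicator {0..1} t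
        = (\<integral>\<^sup>+R. indicator {0..1} t * indicator N (R + t *\<^sub>R adj M) \<partial>lborel)"
      by (subst shift[of t], subst nn_integral_cmult) (auto simp: mult.commute)
  qed
  also have "\<dots> = (\<integral>\<^sup>+R. (\<integral>\<^sup>+t. indicator {0..1::real} t * indicator N (R + t *\<^sub>R adj M) \<partial>lborel) \<partial>lborel)"
    by (rule lborel_pair.Fubini') measurable
  also have "\<dots> = (\<integral>\<^sup>+R. 0 \<partial>(lborel :: ('k^'d^'m) measure))"
  proof (rule nn_integral_cong)
    fix R :: "'k^'d^'m"
    have eq: "M ** (R + t *\<^sub>R adj M) = M ** R + t *\<^sub>R mat 1" for t
      by (simp add: linear_add[OF linear_matrix_mult_left] linear_cmul[OF linear_matrix_mult_left] M)
    have "AE t in lborel. t \<notin> {t. det (M ** R + t *\<^sub>R mat 1) = 0}"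
      using finite_det_add_scaleR_mat_1_eq_0[of "M ** R"]
      by (intro AE_not_in finite_imp_null_set_lborel)
    then have "AE t in lborel. indicator {0..1} t * indicator N (R + t *\<^sub>R adj M) = (0::ennreal)"
      by eventually_elim (auto simp: N_def eq)
    then show "(\<integral>\<^sup>+t. indicator {0..1} t * indicator N (R + t *\<^sub>R adj M) \<partial>lborel) = 0"
      by (subst nn_integral_0_iff_AE) auto
  qed
  finally have "N \<in> null_sets lborel" by (intro null_setsI) auto
  then show ?thesis by (rule AE_I') (auto simp: N_def)
qed

lemma orthogonal_transformation_unitary_mult:
  assumes "unitary (Q::'k^'m^'m)"
  shows "orthogonal_transformation (\<lambda>R::'k^'d^'m. Q ** R)"
  unfolding orthogonal_transformation_def
  using linear_matrix_mult_left[of Q] assms by (simp add: inner_matrix_mult_left)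

text \<open>Left multiplication by \<open>M\<close> is a coisometry, with adjoint left
  multiplication by \<open>adj M\<close>. Thus \<open>X i ** R\<close> has the law of a square
  Gaussian matrix.\<close>

lemma distr_gauss_matrix_mult:
  fixes M :: "'k^'m^'d"
  assumes "0 < s" and "M ** adj M = mat 1"
  shows "distr (gauss s :: ('k^'c^'m) measure) borel (\<lambda>R. M ** R) = gauss s"
proof -
  have "adjoint (\<lambda>R::'k^'c^'m. M ** R) = (\<lambda>Y. adj M ** Y)"
    by (rule adjoint_unique) (simp add: inner_matrix_mult_left)
  then show ?thesis
    using assms by (intro distr_gauss_coisometry linear_matrix_mult_left) (simp_all add: matrix_mul_assoc)
qed

lemma integral_gauss_unitary_mult:
  fixes f :: "'k^'d^'m \<Rightarrow> real"
  assumes Q: "unitary Q" and [measurable]: "f \<in> borel_measurable borel"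
  shows "(\<integral>R. f (Q ** R) \<partial>gauss s) = (\<integral>R. f R \<partial>gauss s)"
proof -
  have "(\<integral>R. f R \<partial>gauss s) = (\<integral>R. f R \<partial>distr (gauss s) borel (\<lambda>R. Q ** R))"
    by (simp add: gauss_orthogonal_transformation orthogonal_transformation_unitary_mult[OF Q])
  also have "\<dots> = (\<integral>R. f (Q ** R) \<partial>gauss s)"
    by (rule integral_distr) auto
  finally show ?thesis ..
qed

text \<open>The linear growth bound serves integrability. By \<open>inner_mat_mult\<close> the last
  clause says that the trace of \<open>\<Phi> G ** adj G\<close> is real.\<close>

definition equivariant :: "('k^'d^'d \<Rightarrow> 'k^'d^'d) \<Rightarrow> bool" where
  "equivariant \<Phi> \<longleftrightarrow> \<Phi> \<in> borel_measurable borel \<and> (\<exists>b. \<forall>G. norm (\<Phi> G) \<le> b * (1 + norm G)) \<and>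
     (\<forall>Q G. unitary Q \<longrightarrow> \<Phi> (Q ** G) = Q ** \<Phi> G) \<and>
     (\<forall>z G. \<Phi> G \<bullet> (mat z ** G) = (1 \<bullet> z) * (\<Phi> G \<bullet> G))"

lemma equivariant_id: "equivariant (\<lambda>G::'k^'d^'d. G)"
proof -
  have "trace (G ** adj G) = of_real (\<Sum>i\<in>UNIV. \<Sum>j\<in>UNIV. (norm (G $ i $ j))\<^sup>2)" for G :: "'k^'d^'d"
    by (simp add: trace_def matrix_matrix_mult_def adj_def mult_cj)
  then have "G \<bullet> (mat z ** G) = (1 \<bullet> z) * (G \<bullet> G)" for z and G :: "'k^'d^'d"
    using inner_mat_mult[of G z G] inner_mat_mult[of G 1 G] by (simp only: inner_of_real) simp
  then show ?thesis by (auto simp: equivariant_def intro!: exI[of _ 1])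
qed

lemma equivariant_polar0: "equivariant (polar0 :: 'k^'d^'d \<Rightarrow> 'k^'d^'d)"
proof -
  have "norm (polar0 G) \<le> sqrt CARD('d) * (1 + norm G)" for G :: "'k^'d^'d"
    by (rule order_trans[OF norm_polar0_le]) (simp add: mult_le_cancel_left1)
  then show ?thesis
    by (auto simp: equivariant_def borel_measurable_polar0 polar0_unitary_mult polar0_inner_mat_mult)
qed

text \<open>The growth bound dominates the integrand by a quadratic polynomial in the norm of
  \<open>R\<close>, which is integrable.\<close>

lemma integrable_equivariant:
  fixes M B :: "'k^'m^'d" and \<Phi> :: "'k^'d^'d \<Rightarrow> 'k^'d^'d"
  assumes s: "0 < s" and \<Phi>: "equivariant \<Phi>"
  shows "integrable (gauss s) (\<lambda>R. \<Phi> (M ** R) \<bullet> (B ** R))"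
proof -
  interpret prob_space "gauss s :: ('k^'d^'m) measure" by (rule prob_space_gauss[OF s])
  have [measurable]: "\<Phi> \<in> borel_measurable borel" using \<Phi> by (simp add: equivariant_def)
  obtain b where b: "\<And>G. norm (\<Phi> G) \<le> b * (1 + norm G)" using \<Phi> by (auto simp: equivariant_def)
  have "0 \<le> norm (\<Phi> 0)" by simp
  also have "\<dots> \<le> b" using b[of 0] by simp
  finally have b0: "0 \<le> b" .
  obtain m where m: "m > 0" "\<And>R::'k^'d^'m. norm (M ** R) \<le> m * norm R"
    using linear_bounded_pos[OF linear_matrix_mult_left[of M]] by blast
  obtain n where n: "n > 0" "\<And>R::'k^'d^'m. norm (B ** R) \<le> n * norm R"
    using linear_bounded_pos[OF linear_matrix_mult_left[of B]] by blast
  have "integrable (gauss s) (\<lambda>R::'k^'d^'m. b * n * ((1 + m) * (norm R)\<^sup>2 + 1))"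
    using has_bochner_integral_gauss_norm_square[OF s, where 'a="'k^'d^'m"]
    by (auto simp: has_bochner_integral_iff)
  then show ?thesis
  proof (rule Bochner_Integration.integrable_bound)
    show "AE R in gauss s. norm (\<Phi> (M ** R) \<bullet> (B ** R)) \<le> norm (b * n * ((1 + m) * (norm R)\<^sup>2 + 1))"
    proof (rule AE_I2)
      fix R :: "'k^'d^'m"
      have "norm (\<Phi> (M ** R) \<bullet> (B ** R)) \<le> norm (\<Phi> (M ** R)) * norm (B ** R)"
        using Cauchy_Schwarz_ineq2 by auto
      also have "\<dots> \<le> (b * (1 + m * norm R)) * (n * norm R)"
      proof (rule mult_mono)
        have "b * (1 + norm (M ** R)) \<le> b * (1 + m * norm R)"
          using m(2)[of R] b0 by (intro mult_left_mono) auto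
        then show "norm (\<Phi> (M ** R)) \<le> b * (1 + m * norm R)" using b[of "M ** R"] by linarith
        show "norm (B ** R) \<le> n * norm R" by (rule n)
      qed (use b0 m in auto)
      also have "\<dots> = b * n * (norm R + m * (norm R)\<^sup>2)" by (simp add: power2_eq_square algebra_simps)
      also have "\<dots> \<le> b * n * ((1 + m) * (norm R)\<^sup>2 + 1)"
      proof (rule mult_left_mono)
        \<comment> \<open>The right-hand side is \<open>2 * (r^2 - r + 1)\<close> for
          \<open>r = norm R\<close>.\<close>
        have "0 \<le> (norm R - 1)\<^sup>2 + (norm R)\<^sup>2 + 1" by simp
        then have "norm R \<le> (norm R)\<^sup>2 + 1" by (simp add: power2_eq_square algebra_simps)
        then show "norm R + m * (norm R)\<^sup>2 \<le> (1 + m) * (norm R)\<^sup>2 + 1" by (simp add: algebra_simps)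
      qed (use b0 n in auto)
      also have "\<dots> \<le> norm (b * n * ((1 + m) * (norm R)\<^sup>2 + 1))" by simp
      finally show "norm (\<Phi> (M ** R) \<bullet> (B ** R)) \<le> norm (b * n * ((1 + m) * (norm R)\<^sup>2 + 1))" .
    qed
  qed measurable
qed

text \<open>Conjugation by sign changes and by transpositions shows that \<open>E[\<Phi>(G) G\<^sup>H]\<close>
  is a scalar matrix.\<close>

lemma integral_equivariant_trace:
  fixes D :: "'k^'d^'d"
  assumes s: "0 < s" and \<Phi>: "equivariant \<Phi>"
  shows "(\<integral>G. \<Phi> G \<bullet> (D ** G) \<partial>gauss s) = (mat 1 \<bullet> D) / CARD('d) * (\<integral>G. \<Phi> G \<bullet> G \<partial>gauss s)"
proof -
  have [measurable]: "\<Phi> \<in> borel_measurable borel" using \<Phi> by (simp add: equivariant_def)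
  \<comment> \<open>\<open>k\<close> is linear over the reals only, so the matrix units below carry
    an arbitrary entry \<open>z\<close>.\<close>
  define k where "k D = (\<integral>G. \<Phi> G \<bullet> (D ** G) \<partial>gauss s)" for D :: "'k^'d^'d"
  have int: "integrable (gauss s) (\<lambda>G. \<Phi> G \<bullet> (D ** G))" for D :: "'k^'d^'d"
    using integrable_equivariant[OF s \<Phi>, of "mat 1" D] by simp
  have lin: "linear k"
    unfolding k_def using int
    by (intro linearI) (simp_all add: inner_add_right linear_add[OF linear_matrix_mult_right]
        linear_cmul[OF linear_matrix_mult_right])
  have conj: "k (adj Q ** D ** Q) = k D" if Q: "unitary Q" for Q D
  proof -
    have "k D = (\<integral>G. \<Phi> (Q ** G) \<bullet> (D ** (Q ** G)) \<partial>gauss s)"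
      unfolding k_def by (subst integral_gauss_unitary_mult[OF Q]) auto
    also have "\<dots> = k (adj Q ** D ** Q)"
      using Q \<Phi> by (simp add: k_def equivariant_def inner_matrix_mult_left matrix_mul_assoc)
    finally show ?thesis ..
  qed
  define E :: "'d \<Rightarrow> 'd \<Rightarrow> 'k \<Rightarrow> 'k^'d^'d" where "E a b z = (\<chi> p q. if p = a \<and> q = b then z else 0)" for a b z
  have off: "k (E a b z) = 0" if "a \<noteq> b" for a b z
  proof -
    \<comment> \<open>Flipping the sign of coordinate \<open>a\<close> negates
      \<open>E a b z\<close>, while \<open>k\<close> is invariant under the conjugation.\<close>
    define Q :: "'k^'d^'d" where "Q = (\<chi> p q. if p = q then if p = a then - 1 else 1 else 0)"
    have adj_Q: "adj Q = Q" by (auto simp: Q_def adj_def vec_eq_iff cj_minus)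
    have QX: "(Q ** X) $ p $ q = (if p = a then - 1 else 1) * X $ p $ q" for X :: "'k^'d^'d" and p q
    proof -
      have "(Q ** X) $ p $ q = (\<Sum>r\<in>UNIV. if r = p then (if p = a then - 1 else 1) * X $ p $ q else 0)"
        unfolding matrix_matrix_mult_def vec_lambda_beta by (rule sum.cong) (auto simp: Q_def)
      then show ?thesis by simp
    qed
    have XQ: "(X ** Q) $ p $ q = (if q = a then - 1 else 1) * X $ p $ q" for X :: "'k^'d^'d" and p q
    proof -
      have "(X ** Q) $ p $ q = (\<Sum>r\<in>UNIV. if r = q then (if q = a then - 1 else 1) * X $ p $ q else 0)"
        unfolding matrix_matrix_mult_def vec_lambda_beta by (rule sum.cong) (auto simp: Q_def)
      then show ?thesis by simp
    qed
    have "Q ** Q = mat 1" by (auto simp: vec_eq_iff QX) (auto simp: Q_def mat_def)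
    then have "unitary Q" by (simp add: unitary_def adj_Q)
    moreover have "adj Q ** E a b z ** Q = - E a b z"
      unfolding vec_eq_iff XQ adj_Q QX using that by (auto simp: E_def)
    ultimately show ?thesis using conj[of Q "E a b z"] by (simp add: linear_neg[OF lin])
  qed
  have diag: "k (E a a z) = k (E b b z)" for a b z
  proof -
    \<comment> \<open>The permutation matrix exchanging \<open>a\<close> and \<open>b\<close>
      conjugates \<open>E a a z\<close> into \<open>E b b z\<close>.\<close>
    define \<sigma> where "\<sigma> = Transposition.transpose a b"
    define Q :: "'k^'d^'d" where "Q = (\<chi> p q. if q = \<sigma> p then 1 else 0)"
    have \<sigma>: "\<sigma> (\<sigma> p) = p" for p by (simp add: \<sigma>_def)
    then have \<sigma>_eq: "q = \<sigma> p \<longleftrightarrow> p = \<sigma> q" for p q by metis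
    have adj_Q: "adj Q = Q" unfolding Q_def adj_def vec_eq_iff vec_lambda_beta using \<sigma>_eq by auto
    have QX: "(Q ** X) $ p $ q = X $ \<sigma> p $ q" for X :: "'k^'d^'d" and p q
    proof -
      have "(Q ** X) $ p $ q = (\<Sum>r\<in>UNIV. if r = \<sigma> p then X $ \<sigma> p $ q else 0)"
        unfolding matrix_matrix_mult_def vec_lambda_beta by (rule sum.cong) (auto simp: Q_def)
      then show ?thesis by simp
    qed
    have XQ: "(X ** Q) $ p $ q = X $ p $ \<sigma> q" for X :: "'k^'d^'d" and p q
    proof -
      have "(X ** Q) $ p $ q = (\<Sum>r\<in>UNIV. if r = \<sigma> q then X $ p $ \<sigma> q else 0)"
        unfolding matrix_matrix_mult_def vec_lambda_beta
        by (rule sum.cong) (use \<sigma> in \<open>auto simp: Q_def\<close>)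
      then show ?thesis by simp
    qed
    have "Q ** Q = mat 1" by (simp add: vec_eq_iff QX) (auto simp: Q_def mat_def \<sigma>)
    then have "unitary Q" by (simp add: unitary_def adj_Q)
    moreover have "adj Q ** E a a z ** Q = E b b z"
    proof -
      have "\<sigma> p = a \<longleftrightarrow> p = b" for p by (metis \<sigma> \<sigma>_def transpose_apply_first)
      then show ?thesis unfolding vec_eq_iff XQ adj_Q QX by (simp add: E_def)
    qed
    ultimately show ?thesis using conj[of Q "E a a z"] by simp
  qed
  \<comment> \<open>The reality clause of \<open>equivariant\<close> leaves only the real part of
    \<open>z\<close>.\<close>
  have scalar: "k (mat z) = (1 \<bullet> z) * k (mat 1)" for z
    using \<Phi> by (simp add: k_def equivariant_def)
  have diag_z: "k (E a a z) = (1 \<bullet> z) * k (mat 1) / CARD('d)" for a z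
  proof -
    have "(\<Sum>c\<in>UNIV. E c c z) $ p $ q = (mat z :: 'k^'d^'d) $ p $ q" for p q
    proof -
      have "(\<Sum>c\<in>UNIV. E c c z) $ p $ q = (\<Sum>c\<in>UNIV. if c = p then (if p = q then z else 0) else 0)"
        unfolding sum_component by (rule sum.cong) (auto simp: E_def)
      then show ?thesis by (simp add: mat_def)
    qed
    then have "mat z = (\<Sum>c\<in>UNIV. E c c z)" by (simp add: vec_eq_iff)
    then have "k (mat z) = (\<Sum>c\<in>UNIV. k (E c c z))"
      by (simp only: linear_sum[OF lin])
    also have "\<dots> = (\<Sum>c\<in>(UNIV::'d set). k (E a a z))"
      by (rule sum.cong[OF refl diag])
    finally have "k (mat z) = CARD('d) * k (E a a z)" by simp
    then show ?thesis using scalar[of z] by simp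
  qed
  have "D = (\<Sum>a\<in>UNIV. \<Sum>b\<in>UNIV. E a b (D $ a $ b))"
  proof -
    have "(\<Sum>a\<in>UNIV. \<Sum>b\<in>UNIV. E a b (D $ a $ b)) $ p $ q = D $ p $ q" for p q
    proof -
      have "(\<Sum>a\<in>UNIV. \<Sum>b\<in>UNIV. E a b (D $ a $ b)) $ p $ q
        = (\<Sum>a\<in>UNIV. \<Sum>b\<in>UNIV. if b = q then if a = p then D $ p $ q else 0 else 0)"
        unfolding sum_component by (intro sum.cong) (auto simp: E_def)
      then show ?thesis by simp
    qed
    then show ?thesis by (simp add: vec_eq_iff)
  qed
  then have "k D = k (\<Sum>a\<in>UNIV. \<Sum>b\<in>UNIV. E a b (D $ a $ b))" by (rule arg_cong)
  also have "\<dots> = (\<Sum>a\<in>UNIV. \<Sum>b\<in>UNIV. k (E a b (D $ a $ b)))"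
    by (simp only: linear_sum[OF lin])
  also have "\<dots> = (\<Sum>a\<in>UNIV. \<Sum>b\<in>UNIV. if b = a then (1 \<bullet> D $ a $ a) * k (mat 1) / CARD('d) else 0)"
    by (intro sum.cong refl) (auto simp: off diag_z)
  also have "\<dots> = (\<Sum>a\<in>UNIV. 1 \<bullet> D $ a $ a) / CARD('d) * k (mat 1)"
    by (simp add: sum_distrib_right sum_divide_distrib)
  also have "(\<Sum>a\<in>UNIV. 1 \<bullet> D $ a $ a) = mat 1 \<bullet> D"
  proof -
    have "mat 1 \<bullet> D = (\<Sum>a\<in>UNIV. \<Sum>b\<in>UNIV. if b = a then 1 \<bullet> D $ a $ a else 0)"
      unfolding inner_vec_def by (intro sum.cong refl) (auto simp: mat_def)
    then show ?thesis by simp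
  qed
  finally show ?thesis by (simp add: k_def)
qed

text \<open>The unitary reflection \<open>2 M\<^sup>H M - I\<close> fixes \<open>M R\<close> and negates the component of \<open>R\<close>
  orthogonal to the row space of \<open>M\<close>, which therefore does not contribute.\<close>

lemma integral_equivariant:
  fixes M B :: "'k^'m^'d"
  assumes s: "0 < s" and \<Phi>: "equivariant \<Phi>" and M: "M ** adj M = mat 1"
  shows "(\<integral>R. \<Phi> (M ** R) \<bullet> (B ** R) \<partial>gauss s) = (M \<bullet> B) / CARD('d) * (\<integral>G. \<Phi> G \<bullet> G \<partial>gauss s)"
proof -
  have [measurable]: "\<Phi> \<in> borel_measurable borel" using \<Phi> by (simp add: equivariant_def)
  define I where "I B = (\<integral>R. \<Phi> (M ** R) \<bullet> (B ** R) \<partial>gauss s)" for B :: "'k^'m^'d"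
  note int = integrable_equivariant[OF s \<Phi>, of M]
  have lin: "linear I"
    unfolding I_def using int
    by (intro linearI) (simp_all add: inner_add_right linear_add[OF linear_matrix_mult_right]
        linear_cmul[OF linear_matrix_mult_right])
  define H where "H = adj M ** M"
  have MH: "M ** H = M" by (simp add: H_def matrix_mul_assoc M)
  have HH: "H ** H = H" by (metis H_def MH matrix_mul_assoc)
  have adj_H: "adj H = H" by (simp add: H_def adj_mult)
  define Q where "Q = 2 *\<^sub>R H - mat 1"
  have XQ: "X ** Q = 2 *\<^sub>R (X ** H) - X" for X :: "'k^'m^'r"
    by (simp add: Q_def linear_diff[OF linear_matrix_mult_left] linear_cmul[OF linear_matrix_mult_left])
  have "adj Q = Q"
    by (simp add: Q_def linear_diff[OF linear_adj] linear_cmul[OF linear_adj] adj_H)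
  moreover have "Q ** Q = mat 1"
  proof -
    have "Q ** H = H"
      by (simp add: Q_def linear_diff[OF linear_matrix_mult_right] linear_cmul[OF linear_matrix_mult_right] HH)
         (simp add: scaleR_2)
    then show ?thesis by (simp add: XQ) (simp add: Q_def)
  qed
  ultimately have Q: "unitary Q" by (simp add: unitary_def)
  have "M ** Q = M" by (simp add: XQ MH) (simp add: scaleR_2)
  have "I B = (\<integral>R. \<Phi> (M ** (Q ** R)) \<bullet> (B ** (Q ** R)) \<partial>gauss s)"
    unfolding I_def by (subst integral_gauss_unitary_mult[OF Q]) auto
  also have "\<dots> = I (B ** Q)" by (simp add: I_def matrix_mul_assoc \<open>M ** Q = M\<close>)
  also have "\<dots> = 2 * I (B ** H) - I B"
    by (simp add: XQ linear_diff[OF lin] linear_cmul[OF lin])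
  finally have "I B = I (B ** H)" by simp
  \<comment> \<open>Now the integrand depends on \<open>R\<close> only through
    \<open>M ** R\<close>, which has the law of \<open>G\<close>.\<close>
  also have "\<dots> = (\<integral>R. \<Phi> (M ** R) \<bullet> ((B ** adj M) ** (M ** R)) \<partial>gauss s)"
    by (simp add: I_def H_def matrix_mul_assoc)
  also have "\<dots> = (\<integral>G. \<Phi> G \<bullet> ((B ** adj M) ** G) \<partial>distr (gauss s :: ('k^'d^'m) measure) borel (\<lambda>R. M ** R))"
    by (subst integral_distr) auto
  also have "\<dots> = (\<integral>G. \<Phi> G \<bullet> ((B ** adj M) ** G) \<partial>gauss s)"
    by (simp add: distr_gauss_matrix_mult[OF s M])
  also have "\<dots> = (mat 1 \<bullet> (B ** adj M)) / CARD('d) * (\<integral>G. \<Phi> G \<bullet> G \<partial>gauss s)"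
    by (rule integral_equivariant_trace[OF s \<Phi>])
  also have "mat 1 \<bullet> (B ** adj M) = M \<bullet> B"
    using inner_matrix_mult_right[of "mat 1" M B] by simp
  finally show ?thesis by (simp add: I_def)
qed

subsection \<open>The rounding inequality\<close>

definition obj :: "'k^('n::finite \<times> 'd::finite)^('n \<times> 'd) \<Rightarrow> ('n \<Rightarrow> 'k^'c::finite^'d) \<Rightarrow> real" where
  "obj C V = (\<Sum>i\<in>UNIV. \<Sum>j\<in>UNIV. trace (adj (blk C i j) ** V i ** adj (V j))) \<bullet> 1"

lemma obj_eq: "obj C V = (\<Sum>i\<in>UNIV. \<Sum>j\<in>UNIV. V i \<bullet> (blk C i j ** V j))"
proof -
  have "trace (adj (blk C i j) ** V i ** adj (V j)) \<bullet> 1 = V i \<bullet> (blk C i j ** V j)" for i j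
    using inner_eq_trace[of "adj (blk C i j) ** V i" "V j"] inner_matrix_mult_left[of "adj (blk C i j)" "V i" "V j"]
    by simp
  then show ?thesis by (simp add: obj_def inner_sum_left)
qed

text \<open>Stacking the \<open>c\<close>-th columns of all \<open>V i\<close> gives a vector
  \<open>x c\<close>; the objective is the sum over \<open>c\<close> of the quadratic form of
  \<open>C\<close> at these vectors.\<close>

lemma obj_nonneg:
  fixes C :: "'k^('n::finite \<times> 'd::finite)^('n \<times> 'd)" and V :: "'n \<Rightarrow> 'k^'c::finite^'d"
  assumes "\<And>x. 0 \<le> x \<bullet> (C *v x)"
  shows "0 \<le> obj C V"
proof -
  define x :: "'c \<Rightarrow> 'k^('n \<times> 'd)" where "x c = (\<chi> p. V (fst p) $ snd p $ c)" for c
  have sum_pair: "(\<Sum>p\<in>UNIV. f p) = (\<Sum>i\<in>UNIV. \<Sum>a\<in>UNIV. f (i, a))" for f :: "'n \<times> 'd \<Rightarrow> 'b::comm_monoid_add"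
    by (simp add: sum.cartesian_product)
  have blk: "(blk C i j ** V j) $ a $ c = (\<Sum>b\<in>UNIV. C $ (i, a) $ (j, b) * V j $ b $ c)" for i j a c
    by (simp add: matrix_matrix_mult_def blk_def)
  have Cx: "(C *v x c) $ (i, a) = (\<Sum>j\<in>UNIV. (blk C i j ** V j) $ a $ c)" for c i a
    by (simp add: matrix_vector_mult_def x_def sum_pair blk)
  have "obj C V = (\<Sum>i\<in>UNIV. \<Sum>a\<in>UNIV. \<Sum>c\<in>UNIV. V i $ a $ c \<bullet> (\<Sum>j\<in>UNIV. (blk C i j ** V j) $ a $ c))"
    unfolding obj_eq inner_sum_right[symmetric] by (simp add: inner_vec_def sum_component)
  also have "\<dots> = (\<Sum>i\<in>UNIV. \<Sum>a\<in>UNIV. \<Sum>c\<in>UNIV. x c $ (i, a) \<bullet> (C *v x c) $ (i, a))"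
    by (simp add: Cx) (simp add: x_def)
  also have "\<dots> = (\<Sum>p\<in>UNIV. \<Sum>c\<in>UNIV. x c $ p \<bullet> (C *v x c) $ p)"
    by (simp add: sum_pair)
  also have "\<dots> = (\<Sum>c\<in>UNIV. x c \<bullet> (C *v x c))"
    unfolding inner_vec_def by (rule sum.swap)
  finally show ?thesis by (simp add: sum_nonneg assms)
qed

text \<open>\<open>s\<close> is the deviation of one real coordinate of an entry. Its normalisation
  makes the expected squared norm of an entry \<open>1 / d\<close> over either field, so that of
  \<open>G\<close> is \<open>d\<close>.\<close>

theorem obj_rounding:
  fixes C :: "'k^('n::finite \<times> 'd::finite)^('n \<times> 'd)" and X :: "'n \<Rightarrow> 'k^('n \<times> 'd)^'d"
    and s :: real and f :: "'k^'d^('n \<times> 'd) \<Rightarrow> ennreal" and g :: "'k^'d^'d \<Rightarrow> ennreal"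
  assumes s: "0 < s" "s\<^sup>2 * (DIM('k) * CARD('d)) = 1"
    and f: "\<And>R. f R = ennreal (gauss_density s R)" and g: "\<And>G. g G = ennreal (gauss_density s G)"
    and psd: "\<And>x. 0 \<le> x \<bullet> (C *v x)"
    and X: "\<And>i. X i ** adj (X i) = mat 1"
    and opt: "\<And>X' :: 'n \<Rightarrow> 'k^('n \<times> 'd)^'d. (\<And>i. X' i ** adj (X' i) = mat 1) \<Longrightarrow> obj C X' \<le> obj C X"
  shows "(integral\<^sup>L (density lebesgue g) (\<lambda>G. sv_sum G / CARD('d)))\<^sup>2 *
      Sup (obj C ` {Q :: 'n \<Rightarrow> 'k^'d^'d. \<forall>i. unitary (Q i)})
    \<le> integral\<^sup>L (density lebesgue f) (\<lambda>R. obj C (\<lambda>i. polar (X i ** R)))"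
proof -
  have [measurable]: "(polar0 :: 'k^'d^'d \<Rightarrow> _) \<in> borel_measurable borel"
    by (rule borel_measurable_polar0)
  define \<alpha> where "\<alpha> = integral\<^sup>L (density lebesgue g) (\<lambda>G. sv_sum G / CARD('d))"
  have \<alpha>: "(\<integral>G. polar0 (G::'k^'d^'d) \<bullet> G \<partial>gauss s) = CARD('d) * \<alpha>"
  proof -
    have "AE G in lborel. det ((mat 1 :: 'k^'d^'d) ** G) \<noteq> 0" by (rule AE_det_mult_nonzero) simp
    then have "AE G in lborel. sv_sum G / CARD('d) = polar0 (G::'k^'d^'d) \<bullet> G / CARD('d)"
      by eventually_elim (simp add: sv_sum_eq_polar polar0_def)
    then have "\<alpha> = (\<integral>G. polar0 (G::'k^'d^'d) \<bullet> G / CARD('d) \<partial>gauss s)"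
      unfolding \<alpha>_def g by (intro integral_density_lebesgue_gauss) auto
    then show ?thesis by simp
  qed
  have norm2: "(\<integral>G. G \<bullet> G \<partial>(gauss s :: ('k^'d^'d) measure)) = CARD('d)"
  proof -
    have "(\<integral>G. G \<bullet> G \<partial>(gauss s :: ('k^'d^'d) measure)) = s\<^sup>2 * DIM('k^'d^'d)"
      using has_bochner_integral_gauss_norm_square[OF s(1), where 'a="'k^'d^'d"]
      by (simp add: has_bochner_integral_iff power2_norm_eq_inner)
    also have "\<dots> = (s\<^sup>2 * (DIM('k) * CARD('d))) * CARD('d)" by simp
    finally show ?thesis using s(2) by simp
  qed
  define V where "V R i = polar0 (X i ** R)" for R i
  have int_VX: "integrable (gauss s) (\<lambda>R. V R i \<bullet> (B ** R))" for i B
    unfolding V_def by (rule integrable_equivariant[OF s(1) equivariant_polar0])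
  have int_XX: "integrable (gauss s :: ('k^'d^('n \<times> 'd)) measure) (\<lambda>R. (X i ** R) \<bullet> (B ** R))" for i B
    by (rule integrable_equivariant[OF s(1) equivariant_id])
  have VX: "(\<integral>R. V R i \<bullet> (B ** R) \<partial>gauss s) = \<alpha> * (X i \<bullet> B)" for i B
    unfolding V_def by (subst integral_equivariant[OF s(1) equivariant_polar0 X]) (simp add: \<alpha>)
  have XX: "(\<integral>R. (X i ** R) \<bullet> (B ** R) \<partial>(gauss s :: ('k^'d^('n \<times> 'd)) measure)) = X i \<bullet> B" for i B
    by (subst integral_equivariant[OF s(1) equivariant_id X]) (simp add: norm2)
  have V_borel [measurable]: "(\<lambda>R. V R i) \<in> borel_measurable borel" for i
    unfolding V_def by measurable
  have int_VV: "integrable (gauss s) (\<lambda>R. V R i \<bullet> (B ** V R j))" for i j and B :: "'k^'d^'d"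
  proof -
    interpret prob_space "gauss s :: ('k^'d^('n \<times> 'd)) measure" by (rule prob_space_gauss[OF s(1)])
    obtain b where b: "\<And>Y::'k^'d^'d. norm (B ** Y) \<le> b * norm Y" "b > 0"
      using linear_bounded_pos[OF linear_matrix_mult_left[of B]] by blast
    show ?thesis
    proof (rule integrable_const_bound[of _ "sqrt CARD('d) * (b * sqrt CARD('d))"])
      show "AE R in gauss s. norm (V R i \<bullet> (B ** V R j)) \<le> sqrt CARD('d) * (b * sqrt CARD('d))"
      proof (rule AE_I2)
        fix R
        have "norm (V R i \<bullet> (B ** V R j)) \<le> norm (V R i) * norm (B ** V R j)"
          using Cauchy_Schwarz_ineq2 by auto
        also have "\<dots> \<le> sqrt CARD('d) * (b * sqrt CARD('d))"
        proof (rule mult_mono)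
          have "b * norm (V R j) \<le> b * sqrt CARD('d)"
            using b(2) norm_polar0_le by (simp add: V_def)
          then show "norm (B ** V R j) \<le> b * sqrt CARD('d)"
            using b(1)[of "V R j"] by linarith
        qed (simp_all add: V_def norm_polar0_le)
        finally show "norm (V R i \<bullet> (B ** V R j)) \<le> sqrt CARD('d) * (b * sqrt CARD('d))" .
      qed
    qed measurable
  qed
  \<comment> \<open>Almost surely all the finitely many \<open>X i ** R\<close> are invertible, and
    there \<open>polar\<close> and \<open>polar0\<close> agree.\<close>
  have round: "integral\<^sup>L (density lebesgue f) (\<lambda>R. obj C (\<lambda>i. polar (X i ** R))) = (\<integral>R. obj C (V R) \<partial>gauss s)"
  proof -
    have "AE R in lborel. \<forall>i\<in>UNIV. det (X i ** R) \<noteq> 0"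
      by (rule AE_finite_allI) (auto intro: AE_det_mult_nonzero[OF X])
    then have "AE R in lborel. obj C (\<lambda>i. polar (X i ** R)) = obj C (V R)"
      by eventually_elim (simp add: obj_eq V_def polar0_def)
    then show ?thesis
      unfolding f by (intro integral_density_lebesgue_gauss) (auto simp: obj_eq)
  qed
  define c where "c i j = X i \<bullet> (blk C i j ** X j)" for i j
  have c: "obj C X = (\<Sum>i\<in>UNIV. \<Sum>j\<in>UNIV. c i j)" by (simp add: obj_eq c_def)
  \<comment> \<open>Both cross terms are brought to the form \<open>V R i \<bullet> (B ** R)\<close>
    covered by \<open>VX\<close>; in the second one the block moves across as its adjoint.\<close>
  have expand: "obj C (\<lambda>i. V R i - \<alpha> *\<^sub>R (X i ** R)) = (\<Sum>i\<in>UNIV. \<Sum>j\<in>UNIV.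
      V R i \<bullet> (blk C i j ** V R j) - \<alpha> * (V R i \<bullet> ((blk C i j ** X j) ** R))
      - \<alpha> * (V R j \<bullet> ((adj (blk C i j) ** X i) ** R)) + \<alpha>\<^sup>2 * ((X i ** R) \<bullet> ((blk C i j ** X j) ** R)))" for R
  proof -
    have "(V R i - \<alpha> *\<^sub>R (X i ** R)) \<bullet> (blk C i j ** (V R j - \<alpha> *\<^sub>R (X j ** R))) =
      V R i \<bullet> (blk C i j ** V R j) - \<alpha> * (V R i \<bullet> ((blk C i j ** X j) ** R))
      - \<alpha> * (V R j \<bullet> ((adj (blk C i j) ** X i) ** R)) + \<alpha>\<^sup>2 * ((X i ** R) \<bullet> ((blk C i j ** X j) ** R))" for i j
    proof -
      have "V R j \<bullet> ((adj (blk C i j) ** X i) ** R) = (X i ** R) \<bullet> (blk C i j ** V R j)"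
        by (subst (2) inner_commute) (simp add: inner_matrix_mult_left matrix_mul_assoc)
      then show ?thesis
        by (simp add: linear_diff[OF linear_matrix_mult_left] linear_cmul[OF linear_matrix_mult_left]
            inner_diff matrix_mul_assoc power2_eq_square algebra_simps)
    qed
    then show ?thesis by (simp add: obj_eq)
  qed
  have adj_c: "X j \<bullet> (adj (blk C i j) ** X i) = c i j" for i j
    unfolding c_def by (subst inner_commute) (simp add: inner_matrix_mult_left)
  \<comment> \<open>Each of the two cross terms contributes \<open>- \<alpha>^2 * c i j\<close> and
    the last term \<open>\<alpha>^2 * c i j\<close>, a net
    \<open>- \<alpha>^2 * c i j\<close>.\<close>
  have "0 \<le> (\<integral>R. obj C (\<lambda>i. V R i - \<alpha> *\<^sub>R (X i ** R)) \<partial>gauss s)"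
    by (intro integral_nonneg_AE AE_I2 obj_nonneg psd)
  also have "\<dots> = (\<Sum>i\<in>UNIV. \<Sum>j\<in>UNIV. (\<integral>R. V R i \<bullet> (blk C i j ** V R j) \<partial>gauss s)
      - \<alpha> * (\<alpha> * c i j) - \<alpha> * (\<alpha> * c i j) + \<alpha>\<^sup>2 * c i j)"
    unfolding expand
    by (simp add: int_VV int_VX int_XX VX XX adj_c c_def[symmetric])
  also have "\<dots> = (\<Sum>i\<in>UNIV. \<Sum>j\<in>UNIV. (\<integral>R. V R i \<bullet> (blk C i j ** V R j) \<partial>gauss s)) - \<alpha>\<^sup>2 * obj C X"
    by (simp add: c sum_subtractf sum.distrib sum_distrib_left power2_eq_square mult.assoc)
  also have "(\<Sum>i\<in>UNIV. \<Sum>j\<in>UNIV. (\<integral>R. V R i \<bullet> (blk C i j ** V R j) \<partial>gauss s)) = (\<integral>R. obj C (V R) \<partial>gauss s)"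
    unfolding obj_eq using int_VV by simp
  finally have main: "\<alpha>\<^sup>2 * obj C X \<le> (\<integral>R. obj C (V R) \<partial>gauss s)" by simp
  have "obj C Q \<le> obj C X" if Q: "\<forall>i. unitary (Q i)" for Q :: "'n \<Rightarrow> 'k^'d^'d"
  proof -
    \<comment> \<open>\<open>J\<close> selects the coordinates of one arbitrary block, the one with
      index \<open>undefined\<close>. Its rows are orthonormal, so the \<open>Q i ** J\<close> are
      feasible for the relaxation with the same objective.\<close>
    define J :: "'k^('n \<times> 'd)^'d" where "J = (\<chi> a p. if p = (undefined :: 'n, a) then 1 else 0)"
    have J: "J ** adj J = mat 1"
    proof -
      have "(J ** adj J) $ a $ b = (\<Sum>p\<in>UNIV. if p = (undefined :: 'n, a) then if a = b then 1 else 0 else 0)" for a b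
        unfolding matrix_matrix_mult_def vec_lambda_beta by (rule sum.cong) (auto simp: J_def adj_def)
      then show ?thesis by (simp add: vec_eq_iff mat_def)
    qed
    have "Q i ** J ** adj (Q i ** J) = mat 1" for i
    proof -
      have "Q i ** J ** adj (Q i ** J) = Q i ** (J ** adj J) ** adj (Q i)"
        by (simp add: adj_mult matrix_mul_assoc)
      then show ?thesis using Q by (simp add: J)
    qed
    then have "obj C (\<lambda>i. Q i ** J) \<le> obj C X" by (rule opt)
    moreover have "obj C (\<lambda>i. Q i ** J) = obj C Q"
    proof -
      have "(Q i ** J) \<bullet> (B ** (Q j ** J)) = Q i \<bullet> (B ** Q j)" for i j and B :: "'k^'d^'d"
      proof -
        have "(Q i ** J) \<bullet> (B ** (Q j ** J)) = Q i \<bullet> (B ** Q j ** (J ** adj J))"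
          by (subst inner_matrix_mult_right) (simp add: matrix_mul_assoc)
        then show ?thesis by (simp add: J)
      qed
      then show ?thesis by (simp add: obj_eq)
    qed
    ultimately show ?thesis by simp
  qed
  then have "Sup (obj C ` {Q :: 'n \<Rightarrow> 'k^'d^'d. \<forall>i. unitary (Q i)}) \<le> obj C X"
    \<comment> \<open>The constant family of identity matrices shows that the supremum is over a
      nonempty set.\<close>
    by (intro cSup_least) (auto intro!: exI[of _ "\<lambda>_. mat 1"])
  then have "\<alpha>\<^sup>2 * Sup (obj C ` {Q :: 'n \<Rightarrow> 'k^'d^'d. \<forall>i. unitary (Q i)}) \<le> \<alpha>\<^sup>2 * obj C X"
    by (rule mult_left_mono) simp
  with main round show ?thesis by (simp add: \<alpha>_def)
qed

end

subsection \<open>The real and the complex case\<close>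

text \<open>Applied to rows and then to entries, this turns the isotropic density of a matrix into
  the product over its entries.\<close>

lemma gauss_density_vec:
  "gauss_density s (x::'a::euclidean_space^'n) = (\<Prod>i\<in>UNIV. gauss_density s (x $ i))"
proof -
  have "(norm x)\<^sup>2 = (\<Sum>i\<in>UNIV. (norm (x $ i))\<^sup>2)"
    by (simp add: power2_norm_eq_inner inner_vec_def)
  then have "exp (- (norm x)\<^sup>2 / (2 * s\<^sup>2)) = (\<Prod>i\<in>UNIV. exp (- (norm (x $ i))\<^sup>2 / (2 * s\<^sup>2)))"
    by (simp add: exp_sum[symmetric] sum_divide_distrib sum_negf)
  then show ?thesis
    by (simp only: gauss_density_def prod.distrib prod_constant) (simp add: power_mult[symmetric] mult.commute)
qed

lemma gauss_density_complex:
  "gauss_density s z = normal_density 0 s (Re z) * normal_density 0 s (Im z)"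
  by (simp add: gauss_density_Basis Basis_complex_def)

lemma gauss_real_mat_eq:
  "gauss_real_mat v = density lebesgue (\<lambda>R. ennreal (gauss_density (sqrt v) (R::real^'c::finite^'r::finite)))"
  by (simp add: gauss_real_mat_def gauss_density_vec gauss_density_real)

lemma gauss_cplx_mat_eq:
  "gauss_cplx_mat v = density lebesgue (\<lambda>R. ennreal (gauss_density (sqrt (v / 2)) (R::complex^'c::finite^'r::finite)))"
  by (simp add: gauss_cplx_mat_def gauss_density_vec gauss_density_complex)

lemma conj_field_real: "conj_field (\<lambda>x::real. x)"
  by (simp add: conj_field_def power2_eq_square)

lemma conj_field_complex: "conj_field cnj"
  by (simp add: conj_field_def inner_complex_def flip: complex_norm_square)

section \<open>Translation of the general notions to the real case\<close>

lemma real_conj_adj: "conj_field.adj (\<lambda>x::real. x) A = transpose A"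
  by (simp add: conj_field.adj_def[OF conj_field_real] transpose_def)

lemma real_conj_unitary: "conj_field.unitary (\<lambda>x::real. x) U = orthogonal_matrix U"
  by (simp only: conj_field.unitary_def[OF conj_field_real] real_conj_adj orthogonal_matrix_def)

lemma real_conj_of_real_mat: "of_real_mat S = (S::real^'d^'d)"
  by (simp add: of_real_mat_def vec_eq_iff)

lemma real_conj_obj: "conj_field.obj (\<lambda>x::real. x) = obj_real"
  by (intro ext) (simp add: conj_field.obj_def[OF conj_field_real] obj_real_def real_conj_adj)

lemma real_conj_polar: "conj_field.polar (\<lambda>x::real. x) = polar_real"
  by (intro ext) (simp add: conj_field.polar_def[OF conj_field_real] polar_real_def
      real_conj_unitary)

lemma real_conj_sv_sum: "conj_field.sv_sum (\<lambda>x::real. x) = sv_sum_real"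
  by (intro ext) (simp only: conj_field.sv_sum_def[OF conj_field_real] sv_sum_real_def
      conj_field.is_svd_def[OF conj_field_real]
      real_conj_of_real_mat real_conj_unitary real_conj_adj conj_assoc)

lemmas real_conj_eq = real_conj_adj real_conj_unitary real_conj_obj real_conj_polar real_conj_sv_sum

section \<open>Translation of the general notions to the complex case\<close>

lemma complex_conj_adj: "conj_field.adj cnj A = cadj A"
  by (simp add: conj_field.adj_def[OF conj_field_complex] cadj_def)

lemma complex_conj_unitary: "conj_field.unitary cnj U = unitary_matrix U"
  by (simp only: conj_field.unitary_def[OF conj_field_complex] complex_conj_adj unitary_matrix_def)

lemma complex_conj_obj: "conj_field.obj cnj = obj_cplx"
  by (intro ext) (simp add: conj_field.obj_def[OF conj_field_complex] obj_cplx_def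
      complex_conj_adj inner_complex_def)

lemma complex_conj_polar: "conj_field.polar cnj = polar_cplx"
  by (intro ext) (simp add: conj_field.polar_def[OF conj_field_complex] polar_cplx_def
      complex_conj_unitary)

lemma complex_conj_sv_sum: "conj_field.sv_sum cnj = sv_sum_cplx"
  by (intro ext) (simp only: conj_field.sv_sum_def[OF conj_field_complex] sv_sum_cplx_def
      conj_field.is_svd_def[OF conj_field_complex]
      of_real_mat_def complex_conj_unitary complex_conj_adj conj_assoc)

lemmas complex_conj_eq = complex_conj_adj complex_conj_unitary complex_conj_obj complex_conj_polar
  complex_conj_sv_sum

theorem theorem1:
  shows
  "(\<forall>(C :: real^('n::finite \<times> 'd::finite)^('n \<times> 'd)) (X :: 'n \<Rightarrow> real^('n \<times> 'd)^'d).
      psd_real C \<longrightarrow>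
      (\<forall>i. X i ** transpose (X i) = mat 1) \<longrightarrow>
      (\<forall>X' :: 'n \<Rightarrow> real^('n \<times> 'd)^'d. (\<forall>i. X' i ** transpose (X' i) = mat 1) \<longrightarrow> obj_real C X' \<le> obj_real C X) \<longrightarrow>
      integral\<^sup>L (gauss_real_mat (1 / real CARD('d)) :: (real^'d^('n \<times> 'd)) measure)
          (\<lambda>R. obj_real C (\<lambda>i. polar_real (X i ** R)))
        \<ge> (alpha_real TYPE('d))\<^sup>2 *
          Sup (obj_real C ` {Q :: 'n \<Rightarrow> real^'d^'d. \<forall>i. orthogonal_matrix (Q i)}))
   \<and>
   (\<forall>(C :: complex^('n \<times> 'd)^('n \<times> 'd)) (Y :: 'n \<Rightarrow> complex^('n \<times> 'd)^'d).
      psd_herm C \<longrightarrow>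
      (\<forall>i. Y i ** cadj (Y i) = mat 1) \<longrightarrow>
      (\<forall>Y' :: 'n \<Rightarrow> complex^('n \<times> 'd)^'d. (\<forall>i. Y' i ** cadj (Y' i) = mat 1) \<longrightarrow> obj_cplx C Y' \<le> obj_cplx C Y) \<longrightarrow>
      integral\<^sup>L (gauss_cplx_mat (1 / real CARD('d)) :: (complex^'d^('n \<times> 'd)) measure)
          (\<lambda>R. obj_cplx C (\<lambda>i. polar_cplx (Y i ** R)))
        \<ge> (alpha_cplx TYPE('d))\<^sup>2 *
          Sup (obj_cplx C ` {U :: 'n \<Rightarrow> complex^'d^'d. \<forall>i. unitary_matrix (U i)}))"
proof (intro conjI allI impI)
  fix C :: "real^('n \<times> 'd)^('n \<times> 'd)" and X :: "'n \<Rightarrow> real^('n \<times> 'd)^'d"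
  assume "psd_real C" and X: "\<forall>i. X i ** transpose (X i) = mat 1"
    and opt: "\<forall>X' :: 'n \<Rightarrow> real^('n \<times> 'd)^'d. (\<forall>i. X' i ** transpose (X' i) = mat 1) \<longrightarrow> obj_real C X' \<le> obj_real C X"
  then have psd: "0 \<le> x \<bullet> (C *v x)" for x by (simp add: psd_real_def)
  show "(alpha_real TYPE('d))\<^sup>2 * Sup (obj_real C ` {Q :: 'n \<Rightarrow> real^'d^'d. \<forall>i. orthogonal_matrix (Q i)})
      \<le> integral\<^sup>L (gauss_real_mat (1 / real CARD('d)) :: (real^'d^('n \<times> 'd)) measure)
          (\<lambda>R. obj_real C (\<lambda>i. polar_real (X i ** R)))"
    unfolding alpha_real_def gauss_real_mat_eq
    using X opt psd
    by (intro conj_field.obj_rounding[OF conj_field_real, where s="sqrt (1 / CARD('d))" and C=C and X=X,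
          unfolded real_conj_eq]) auto
next
  fix C :: "complex^('n \<times> 'd)^('n \<times> 'd)" and Y :: "'n \<Rightarrow> complex^('n \<times> 'd)^'d"
  assume C: "psd_herm C" and Y: "\<forall>i. Y i ** cadj (Y i) = mat 1"
    and opt: "\<forall>Y' :: 'n \<Rightarrow> complex^('n \<times> 'd)^'d. (\<forall>i. Y' i ** cadj (Y' i) = mat 1) \<longrightarrow> obj_cplx C Y' \<le> obj_cplx C Y"
  have "x \<bullet> (C *v x) = Re (\<Sum>k\<in>UNIV. cnj (x $ k) * (C *v x) $ k)" for x
    by (simp add: inner_vec_def inner_complex_def)
  then have psd: "0 \<le> x \<bullet> (C *v x)" for x using C by (simp add: psd_herm_def)
  show "(alpha_cplx TYPE('d))\<^sup>2 * Sup (obj_cplx C ` {U :: 'n \<Rightarrow> complex^'d^'d. \<forall>i. unitary_matrix (U i)})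
      \<le> integral\<^sup>L (gauss_cplx_mat (1 / real CARD('d)) :: (complex^'d^('n \<times> 'd)) measure)
          (\<lambda>R. obj_cplx C (\<lambda>i. polar_cplx (Y i ** R)))"
    \<comment> \<open>The variance \<open>1 / d\<close> of a complex entry splits evenly between its
      real and imaginary parts, hence the extra division by \<open>2\<close> in
      \<open>s\<close>.\<close>
    unfolding alpha_cplx_def gauss_cplx_mat_eq
    using Y opt psd
    by (intro conj_field.obj_rounding[OF conj_field_complex, where s="sqrt (1 / CARD('d) / 2)" and C=C and X=Y,
          unfolded complex_conj_eq]) auto
qed

end
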